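(* Fix integers $m \ge r \ge 2$ and a nondegenerate $r$-graph $F$ on $m$ vertices. Suppose that there exists a constant $c>0$ such that for all sufficiently large $n \in \mathbb{N}$: (a) $F$ is $\left(c\binom{n}{r-1}, \frac{1-\pi(F)}{4m}\binom{n}{r-1}\right)$-bounded, i.e. every $F$-free $r$-graph $\mathcal{H}$ on $n$ vertices with average degree $d(\mathcal{H}) \ge d(n,F) - c\binom{n}{r-1}$ satisfies $\Delta(\mathcal{H}) \le d(n,F) + \frac{1-\pi(F)}{4m}\binom{n}{r-1}$; and (b) $\mathrm{ex}(n,F)$ is $\frac{1-\pi(F)}{8m}\binom{n}{r-1}$-smooth, i.e. $\left|\delta(n,F) - d(n-1,F)\right| \le \frac{1-\pi(F)}{8m}\binom{n}{r-1}$. Then there exists $N_0$ such that for all integers $n \ge N_0$ and all integers $t \ge 0$ with $t \le \min\left\{\frac{c}{4erm}n, \frac{1-\pi(F)}{64rm^2}n\right\}$ we have \[ \mathrm{EX}(n,(t+1)F) = K_t^r \bowtie \mathrm{EX}(n-t,F), \] and in particular \[ \mathrm{ex}(n,(t+1)F) = \binom{n}{r} - \binom{n-t}{r} + \mathrm{ex}(n-t,F). \]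
   Context: An $r$-graph is a collection of $r$-element subsets (edges) of a finite vertex set; $r$-graphs are considered up to isomorphism. For $r$-graphs $F,\mathcal{H}$, $\nu(F,\mathcal{H})$ is the maximum $k$ such that $\mathcal{H}$ contains $k$ pairwise vertex-disjoint copies of $F$; $\mathcal{H}$ is $F$-free if $\nu(F,\mathcal{H})=0$. $\mathrm{ex}(n,F)$ is the maximum number of edges of an $n$-vertex $F$-free $r$-graph and $\mathrm{EX}(n,F)$ is the set of $n$-vertex $F$-free $r$-graphs with exactly $\mathrm{ex}(n,F)$ edges. $\mathrm{ex}(n,(t+1)F)$ is the maximum number of edges in an $n$-vertex $r$-graph $\mathcal{H}$ with $\nu(F,\mathcal{H})<t+1$, and $\mathrm{EX}(n,(t+1)F)$ is the set of such $n$-vertex $r$-graphs with exactly $\mathrm{ex}(n,(t+1)F)$ edges. $\pi(F)=\lim_{n\to\infty}\mathrm{ex}(n,F)/\binom{n}{r}$ is the Turán density, and $F$ is nondegenerate if $\pi(F)>0$. $d(n,F) := r\cdot\mathrm{ex}(n,F)/n$ and $\delta(n,F) := \mathrm{ex}(n,F)-\mathrm{ex}(n-1,F)$. For an $r$-graph $\mathcal{H}$, $d(\mathcal{H})$ and $\Delta(\mathcal{H})$ denote its average and maximum vertex degree (degree = number of edges containing the vertex). $K_t^r$ is the complete $r$-graph on $t$ vertices. For $r$-graphs $\mathcal{G},\mathcal{H}$ on disjoint vertex sets, the join $\mathcal{G}\bowtie\mathcal{H}$ is the $r$-graph on $V(\mathcal{G})\cup V(\mathcal{H})$ consisting of all edges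 of $\mathcal{G}$, all edges of $\mathcal{H}$, and all $r$-subsets meeting both $V(\mathcal{G})$ and $V(\mathcal{H})$; for a family $\mathcal{F}$, $\mathcal{G}\bowtie\mathcal{F} := \{\mathcal{G}\bowtie\mathcal{H} : \mathcal{H}\in\mathcal{F}\}$. *)

theory Defs
  imports Complex_Main
begin

record 'a hypergraph =
  verts :: "'a set"
  edges :: "'a set set"

definition rgraph :: "nat \<Rightarrow> 'a hypergraph \<Rightarrow> bool" where
  "rgraph r H \<longleftrightarrow> finite (verts H) \<and> (\<forall>e\<in>edges H. e \<subseteq> verts H \<and> card e = r)"

definition isomorphic :: "'a hypergraph \<Rightarrow> 'b hypergraph \<Rightarrow> bool" where
  "isomorphic G H \<longleftrightarrow>
     (\<exists>f. bij_betw f (verts G) (verts H) \<and> edges H = (\<lambda>e. f ` e) ` edges G)"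

(* Not necessarily induced subgraphs of H that are isomorphic to F;
   isolated vertices of F count as part of a copy. *)
definition copies :: "'b hypergraph \<Rightarrow> 'a hypergraph \<Rightarrow> 'a hypergraph set" where
  "copies F H = {G. verts G \<subseteq> verts H \<and> edges G \<subseteq> edges H \<and> isomorphic F G}"

definition nu :: "'b hypergraph \<Rightarrow> 'a hypergraph \<Rightarrow> nat" where
  "nu F H = Max {card M |M. M \<subseteq> copies F H \<and>
                             pairwise (\<lambda>G G'. disjnt (verts G) (verts G')) M}"

definition F_free :: "'b hypergraph \<Rightarrow> 'a hypergraph \<Rightarrow> bool" where
  "F_free F H \<longleftrightarrow> nu F H = 0"

(* Host r-graphs range over all finite vertex sets of natural numbers, so that
   the families below contain every r-graph of the required kind up to
   isomorphism, and are closed under isomorphism within this universe. *)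
definition ex_num :: "nat \<Rightarrow> nat \<Rightarrow> 'b hypergraph \<Rightarrow> nat" where
  "ex_num r n F = Max {card (edges H) |H :: nat hypergraph.
                     rgraph r H \<and> card (verts H) = n \<and> F_free F H}"

definition EX_fam :: "nat \<Rightarrow> nat \<Rightarrow> 'b hypergraph \<Rightarrow> nat hypergraph set" where
  "EX_fam r n F = {H. rgraph r H \<and> card (verts H) = n \<and> F_free F H \<and>
                  card (edges H) = ex_num r n F}"

(* ex(n, k F) and EX(n, k F): fewer than k pairwise vertex-disjoint copies of F. *)
definition ex_num_mult :: "nat \<Rightarrow> nat \<Rightarrow> nat \<Rightarrow> 'b hypergraph \<Rightarrow> nat" where
  "ex_num_mult r n k F = Max {card (edges H) |H :: nat hypergraph.
                            rgraph r H \<and> card (verts H) = n \<and> nu F H < k}"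

definition EX_fam_mult :: "nat \<Rightarrow> nat \<Rightarrow> nat \<Rightarrow> 'b hypergraph \<Rightarrow> nat hypergraph set" where
  "EX_fam_mult r n k F = {H. rgraph r H \<and> card (verts H) = n \<and> nu F H < k \<and>
                         card (edges H) = ex_num_mult r n k F}"

definition turan_density :: "nat \<Rightarrow> 'b hypergraph \<Rightarrow> real" where
  "turan_density r F = lim (\<lambda>n. real (ex_num r n F) / real (n choose r))"

definition nondegenerate :: "nat \<Rightarrow> 'b hypergraph \<Rightarrow> bool" where
  "nondegenerate r F \<longleftrightarrow> turan_density r F > 0"

definition ex_avg_deg :: "nat \<Rightarrow> nat \<Rightarrow> 'b hypergraph \<Rightarrow> real" where
  "ex_avg_deg r n F = real r * real (ex_num r n F) / real n"

definition ex_diff :: "nat \<Rightarrow> nat \<Rightarrow> 'b hypergraph \<Rightarrow> real" where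
  "ex_diff r n F = real (ex_num r n F) - real (ex_num r (n - 1) F)"

definition vdegree :: "'a hypergraph \<Rightarrow> 'a \<Rightarrow> nat" where
  "vdegree H v = card {e \<in> edges H. v \<in> e}"

definition avg_degree :: "'a hypergraph \<Rightarrow> real" where
  "avg_degree H = (\<Sum>v\<in>verts H. real (vdegree H v)) / real (card (verts H))"

definition max_degree :: "'a hypergraph \<Rightarrow> nat" where
  "max_degree H = Max (vdegree H ` verts H)"

(* Boundedness and smoothness at one fixed n; a, b, g are the values there of
   the functions of n that parametrise these notions. *)
definition bounded_at :: "nat \<Rightarrow> 'b hypergraph \<Rightarrow> nat \<Rightarrow> real \<Rightarrow> real \<Rightarrow> bool" where
  "bounded_at r F n a b \<longleftrightarrow>
     (\<forall>H :: nat hypergraph. rgraph r H \<and> card (verts H) = n \<and> F_free F H \<and>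
        avg_degree H \<ge> ex_avg_deg r n F - a \<longrightarrow>
        real (max_degree H) \<le> ex_avg_deg r n F + b)"

definition smooth_at :: "nat \<Rightarrow> 'b hypergraph \<Rightarrow> nat \<Rightarrow> real \<Rightarrow> bool" where
  "smooth_at r F n g \<longleftrightarrow> \<bar>ex_diff r n F - ex_avg_deg r (n - 1) F\<bar> \<le> g"

definition complete_rgraph :: "nat \<Rightarrow> nat \<Rightarrow> nat hypergraph" where
  "complete_rgraph r t = \<lparr>verts = {..<t}, edges = {e. e \<subseteq> {..<t} \<and> card e = r}\<rparr>"

(* Intended for disjoint vertex sets. *)
definition join :: "nat \<Rightarrow> 'a hypergraph \<Rightarrow> 'a hypergraph \<Rightarrow> 'a hypergraph" where
  "join r G H =
     \<lparr>verts = verts G \<union> verts H,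
      edges = edges G \<union> edges H \<union>
        {e. e \<subseteq> verts G \<union> verts H \<and> card e = r \<and>
            e \<inter> verts G \<noteq> {} \<and> e \<inter> verts H \<noteq> {}}\<rparr>"

(* r-graphs are considered up to isomorphism: all joins of vertex-disjoint
   isomorphic copies of G and of a member of the family, so that the result is
   again closed under isomorphism and equality with EX_fam_mult is equality of
   families of isomorphism types. *)
definition join_family ::
  "nat \<Rightarrow> nat hypergraph \<Rightarrow> nat hypergraph set \<Rightarrow> nat hypergraph set" where
  "join_family r G \<F> =
     {join r G' H' |G' H'. isomorphic G G' \<and> (\<exists>H\<in>\<F>. isomorphic H H') \<and>
                           disjnt (verts G') (verts H')}"

end

theory Submission
  imports Defs
begin

text \<open>Write \<open>q = 1 - \<pi>(F)\<close> and let \<open>H\<close> have at most \<open>t\<close> disjoint copies of \<open>F\<close> and at least as many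
  edges as \<open>K\<^sub>t \<bowtie> EX(n - t, F)\<close>. The key point is that, if \<open>t \<ge> 1\<close>, some vertex \<open>v\<close> satisfies
  \<open>\<nu>(H - v) < t\<close>. Otherwise every \<open>v\<close> is avoided by \<open>t\<close> disjoint copies; removing their \<open>m t\<close>
  vertices leaves an \<open>F\<close>-free graph containing \<open>v\<close> that is still dense enough for boundedness, so
  \<open>deg v\<close> is at most about \<open>(\<pi>(F) + q / (4 m)) binom(n, r - 1)\<close>. Deleting a set of \<open>m t\<close> vertices
  that meets every copy of \<open>F\<close> then bounds the number of edges of \<open>H\<close> by \<open>ex(n - m t, F)\<close> plus
  \<open>m t\<close> such degrees, which by smoothness is smaller than the assumed number of edges.
  Given such a \<open>v\<close>, induction on \<open>t\<close> applies to \<open>H - v\<close>, and counting edges forces every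
  \<open>r\<close>-set containing \<open>v\<close> to be an edge. The hypotheses on \<open>n\<close> and \<open>t\<close> used in the induction,
  \<open>N + m t \<le> n\<close> and \<open>t \<le> \<epsilon> n\<close>, pass from \<open>(n, t)\<close> to \<open>(n - 1, t - 1)\<close>.\<close>

section \<open>Copies, packings and vertex deletion\<close>

definition delete :: "'a hypergraph \<Rightarrow> 'a set \<Rightarrow> 'a hypergraph" where
  "delete H W = \<lparr>verts = verts H - W, edges = {e \<in> edges H. e \<inter> W = {}}\<rparr>"

definition embeds :: "'b hypergraph \<Rightarrow> 'a hypergraph \<Rightarrow> bool" where
  "embeds F H \<longleftrightarrow>
     (\<exists>f. inj_on f (verts F) \<and> f ` verts F \<subseteq> verts H \<and> (\<forall>e\<in>edges F. f ` e \<in> edges H))"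

definition packing :: "'b hypergraph \<Rightarrow> 'a hypergraph \<Rightarrow> 'a hypergraph set \<Rightarrow> bool" where
  "packing F H M \<longleftrightarrow>
     M \<subseteq> copies F H \<and> pairwise (\<lambda>G G'. disjnt (verts G) (verts G')) M"

lemma verts_delete [simp]: "verts (delete H W) = verts H - W"
  and edges_delete [simp]: "edges (delete H W) = {e \<in> edges H. e \<inter> W = {}}"
  by (simp_all add: delete_def)

lemma rgraph_delete: "rgraph r H \<Longrightarrow> rgraph r (delete H W)"
  by (auto simp: rgraph_def)

lemma finite_edges: "rgraph r H \<Longrightarrow> finite (edges H)"
  by (rule finite_subset[of _ "Pow (verts H)"]) (auto simp: rgraph_def)

text \<open>\<open>nu\<close> is a \<open>Max\<close> and is meaningful only over a finite set; a
  hypergraph is determined by its vertex and edge sets, which here range over finite power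
  sets.\<close>

lemma finite_copies:
  assumes "rgraph r H"
  shows "finite (copies F H)"
proof (rule finite_subset)
  show "copies F H \<subseteq> (\<lambda>(V, E). \<lparr>verts = V, edges = E\<rparr>) ` (Pow (verts H) \<times> Pow (edges H))"
  proof
    fix G assume "G \<in> copies F H"
    moreover have "G = (\<lambda>(V, E). \<lparr>verts = V, edges = E\<rparr>) (verts G, edges G)" by simp
    ultimately show "G \<in> (\<lambda>(V, E). \<lparr>verts = V, edges = E\<rparr>) ` (Pow (verts H) \<times> Pow (edges H))"
      unfolding copies_def by blast
  qed
qed (use assms finite_edges[OF assms] in \<open>auto simp: rgraph_def\<close>)

lemma copies_nonempty_iff: "copies F H \<noteq> {} \<longleftrightarrow> embeds F H"
proof
  assume "copies F H \<noteq> {}"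
  then obtain G where "G \<in> copies F H" by blast
  then obtain f where "verts G \<subseteq> verts H" "edges G \<subseteq> edges H"
    "bij_betw f (verts F) (verts G)" "edges G = (\<lambda>e. f ` e) ` edges F"
    by (auto simp: copies_def isomorphic_def)
  then show "embeds F H"
    unfolding embeds_def by (intro exI[of _ f]) (auto simp: bij_betw_def)
next
  assume "embeds F H"
  then obtain f where f: "inj_on f (verts F)" "f ` verts F \<subseteq> verts H"
    "\<forall>e\<in>edges F. f ` e \<in> edges H"
    by (auto simp: embeds_def)
  then have "\<lparr>verts = f ` verts F, edges = (\<lambda>e. f ` e) ` edges F\<rparr> \<in> copies F H"
    by (auto simp: copies_def isomorphic_def intro!: exI[of _ f] inj_on_imp_bij_betw)
  then show "copies F H \<noteq> {}" by blast
qed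

lemma embeds_mono:
  "embeds F G \<Longrightarrow> verts G \<subseteq> verts H \<Longrightarrow> edges G \<subseteq> edges H \<Longrightarrow> embeds F H"
  unfolding embeds_def by (meson subsetD subset_trans)

lemma nu_def': "nu F H = Max (card ` {M. packing F H M})"
  unfolding nu_def packing_def by (rule arg_cong[of _ _ Max]) auto

lemma finite_packings:
  assumes "rgraph r H"
  shows "finite {M. packing F H M}"
  by (rule finite_subset[of _ "Pow (copies F H)"])
    (use finite_copies[OF assms] in \<open>auto simp: packing_def\<close>)

lemma card_packing_le_nu:
  assumes "rgraph r H" "packing F H M"
  shows "card M \<le> nu F H"
  unfolding nu_def' using finite_packings[OF assms(1)] assms(2) by (intro Max_ge) auto

lemma nu_packing:
  assumes "rgraph r H"
  obtains M where "packing F H M" "card M = nu F H"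
proof -
  have "packing F H {}" by (simp add: packing_def)
  then have "nu F H \<in> card ` {M. packing F H M}"
    unfolding nu_def' using finite_packings[OF assms] by (intro Max_in) auto
  then show ?thesis using that by auto
qed

lemma F_free_iff:
  assumes "rgraph r H"
  shows "F_free F H \<longleftrightarrow> \<not> embeds F H"
proof
  assume free: "F_free F H"
  show "\<not> embeds F H"
  proof
    assume "embeds F H"
    then obtain G where "G \<in> copies F H" using copies_nonempty_iff by blast
    then have "packing F H {G}" by (simp add: packing_def)
    from card_packing_le_nu[OF assms this] free show False by (simp add: F_free_def)
  qed
next
  assume "\<not> embeds F H"
  then have "copies F H = {}" using copies_nonempty_iff by blast
  moreover obtain M where "packing F H M" "card M = nu F H" using nu_packing[OF assms] .
  ultimately show "F_free F H" by (auto simp: F_free_def packing_def)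
qed

lemma F_free_delete_mono:
  assumes "rgraph r H" "F_free F (delete H W)" "W \<subseteq> W'"
  shows "F_free F (delete H W')"
proof -
  have "\<not> embeds F (delete H W)"
    using assms F_free_iff rgraph_delete by blast
  then have "\<not> embeds F (delete H W')"
    using embeds_mono[of F "delete H W'" "delete H W"] assms(3) by auto
  then show ?thesis using assms(1) F_free_iff rgraph_delete by blast
qed

lemma packing_mono:
  "packing F G M \<Longrightarrow> verts G \<subseteq> verts H \<Longrightarrow> edges G \<subseteq> edges H \<Longrightarrow> packing F H M"
  unfolding packing_def copies_def by blast

section \<open>Isomorphisms\<close>

text \<open>Since the edges of an \<open>rgraph\<close> lie inside its vertex set,
  \<open>inv_into\<close> undoes \<open>f\<close> edge by edge.\<close>

lemma isomorphic_sym: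
  assumes "rgraph r G" "isomorphic G H"
  shows "isomorphic H G"
proof -
  obtain f where f: "bij_betw f (verts G) (verts H)" "edges H = (\<lambda>e. f ` e) ` edges G"
    using assms(2) by (auto simp: isomorphic_def)
  let ?g = "inv_into (verts G) f"
  have "?g ` f ` e = e" if "e \<in> edges G" for e
    using that f(1) assms(1) by (intro inv_into_image_cancel) (auto simp: bij_betw_def rgraph_def)
  then have "edges G = (\<lambda>e. ?g ` e) ` edges H"
    unfolding f(2) image_image by force
  then show ?thesis
    unfolding isomorphic_def using bij_betw_inv_into[OF f(1)] by blast
qed

lemma isomorphic_rgraph:
  assumes "rgraph r G" "isomorphic G H"
  shows "rgraph r H" "card (verts H) = card (verts G)" "card (edges H) = card (edges G)"
proof -
  obtain f where f: "bij_betw f (verts G) (verts H)" "edges H = (\<lambda>e. f ` e) ` edges G"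
    using assms(2) by (auto simp: isomorphic_def)
  have sub: "\<forall>e\<in>edges G. e \<subseteq> verts G" using assms(1) by (auto simp: rgraph_def)
  have inj: "inj_on f (verts G)" using f(1) by (simp add: bij_betw_def)
  have "finite (verts H)" using f(1) assms(1) bij_betw_finite by (auto simp: rgraph_def)
  moreover have "f ` e \<subseteq> verts H \<and> card (f ` e) = r" if "e \<in> edges G" for e
    using that sub f(1) inj assms(1)
    by (auto simp: bij_betw_def rgraph_def card_image inj_on_subset)
  ultimately show "rgraph r H" unfolding rgraph_def f(2) by blast
  show "card (verts H) = card (verts G)" using bij_betw_same_card[OF f(1)] by simp
  have "inj_on (\<lambda>e. f ` e) (edges G)"
    using sub inj by (intro inj_onI) (metis inj_on_image_eq_iff)
  then show "card (edges H) = card (edges G)" unfolding f(2) by (rule card_image)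
qed

lemma embeds_isomorphic:
  assumes "rgraph r F" "embeds F G" "isomorphic G H"
  shows "embeds F H"
proof -
  obtain f where f: "inj_on f (verts F)" "f ` verts F \<subseteq> verts G" "\<forall>e\<in>edges F. f ` e \<in> edges G"
    using assms(2) by (auto simp: embeds_def)
  obtain g where g: "bij_betw g (verts G) (verts H)" "edges H = (\<lambda>e. g ` e) ` edges G"
    using assms(3) by (auto simp: isomorphic_def)
  have "inj_on (g \<circ> f) (verts F)"
    using f g(1) by (intro comp_inj_on) (auto simp: bij_betw_def inj_on_subset)
  moreover have "(g \<circ> f) ` verts F \<subseteq> verts H"
    using f(2) g(1) by (auto simp: bij_betw_def)
  moreover have "\<forall>e\<in>edges F. (g \<circ> f) ` e \<in> edges H"
    using f(3) g(2) by (auto simp: image_comp[symmetric])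
  ultimately show ?thesis unfolding embeds_def by blast
qed

lemma F_free_isomorphic:
  assumes "rgraph r F" "rgraph r G" "F_free F G" "isomorphic G H"
  shows "F_free F H"
  using assms(3) embeds_isomorphic[OF assms(1) _ isomorphic_sym[OF assms(2,4)]]
    F_free_iff[OF assms(2)] F_free_iff[OF isomorphic_rgraph(1)[OF assms(2,4)]] by blast

lemma EX_fam_isomorphic:
  assumes "rgraph r F" "H \<in> EX_fam r n F" "isomorphic H H'"
  shows "H' \<in> EX_fam r n F"
proof -
  have "rgraph r H" "F_free F H" using assms(2) by (auto simp: EX_fam_def)
  then show ?thesis
    using assms isomorphic_rgraph[OF \<open>rgraph r H\<close> assms(3)] F_free_isomorphic[of r F H H']
    by (auto simp: EX_fam_def)
qed

lemma isomorphic_refl: "isomorphic H H"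
  unfolding isomorphic_def by (rule exI[of _ id]) auto

text \<open>Every \<open>r\<close>-subset of \<open>verts G\<close> is the image of its preimage in
  \<open>{..<t}\<close>, so the vertex set determines the edges. In joins this turns copies of the
  complete graph into plain sets of \<open>t\<close> vertices.\<close>

lemma isomorphic_complete_iff:
  "isomorphic (complete_rgraph r t) G \<longleftrightarrow>
     finite (verts G) \<and> card (verts G) = t \<and> edges G = {e. e \<subseteq> verts G \<and> card e = r}"
proof -
  have img: "(\<lambda>e. f ` e) ` {e. e \<subseteq> {..<t} \<and> card e = r} = {e. e \<subseteq> verts G \<and> card e = r}"
    if f: "bij_betw f {..<t} (verts G)" for f
  proof -
    have inj: "inj_on f {..<t}" and im: "f ` {..<t} = verts G"
      using f by (auto simp: bij_betw_def)
    have "e \<in> (\<lambda>e. f ` e) ` {e. e \<subseteq> {..<t} \<and> card e = r}"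
      if "e \<subseteq> verts G" "card e = r" for e
    proof -
      let ?e' = "{..<t} \<inter> f -` e"
      have img: "f ` ?e' = e" using that(1) unfolding im[symmetric] by blast
      moreover have "card (f ` ?e') = card ?e'"
        by (rule card_image) (rule inj_on_subset[OF inj], simp)
      ultimately show ?thesis using that(2) by (intro image_eqI[of _ _ ?e']) auto
    qed
    moreover have "f ` e \<subseteq> verts G" "card (f ` e) = card e" if "e \<subseteq> {..<t}" for e
      using that im card_image[OF inj_on_subset[OF inj that]] by blast+
    ultimately show ?thesis by (intro equalityI image_subsetI subsetI CollectI) simp_all
  qed
  show ?thesis
  proof
    assume "isomorphic (complete_rgraph r t) G"
    then obtain f where f: "bij_betw f {..<t} (verts G)"
      "edges G = (\<lambda>e. f ` e) ` {e. e \<subseteq> {..<t} \<and> card e = r}"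
      by (auto simp: isomorphic_def complete_rgraph_def)
    then show "finite (verts G) \<and> card (verts G) = t \<and> edges G = {e. e \<subseteq> verts G \<and> card e = r}"
      using img[OF f(1)] bij_betw_finite[OF f(1)] bij_betw_same_card[OF f(1)] by simp
  next
    assume G: "finite (verts G) \<and> card (verts G) = t \<and> edges G = {e. e \<subseteq> verts G \<and> card e = r}"
    then obtain f where f: "bij_betw f {..<t} (verts G)"
      using finite_same_card_bij[of "{..<t}" "verts G"] by auto
    then show "isomorphic (complete_rgraph r t) G"
      unfolding isomorphic_def complete_rgraph_def using img[OF f] G by (intro exI[of _ f]) simp
  qed
qed

section \<open>Counting edges\<close>

text \<open>Removing \<open>A\<close> is a bijection onto the \<open>(r - card A)\<close>-subsets of
  \<open>V - A\<close>. With one or two elements in \<open>A\<close> this bounds degrees and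
  codegrees.\<close>

lemma card_supersets:
  assumes "finite V" "A \<subseteq> V" "card A \<le> r"
  shows "card {e. e \<subseteq> V \<and> card e = r \<and> A \<subseteq> e} = (card V - card A) choose (r - card A)"
proof -
  have fA: "finite A" using assms finite_subset by blast
  have "bij_betw (\<lambda>e. e \<union> A) {e. e \<subseteq> V - A \<and> card e = r - card A}
          {e. e \<subseteq> V \<and> card e = r \<and> A \<subseteq> e}"
  proof (rule bij_betw_byWitness[where f' = "\<lambda>e. e - A"])
    show "(\<lambda>e. e \<union> A) ` {e. e \<subseteq> V - A \<and> card e = r - card A} \<subseteq> {e. e \<subseteq> V \<and> card e = r \<and> A \<subseteq> e}"
    proof clarsimp
      fix e assume e: "e \<subseteq> V - A" "card e = r - card A"
      then have "finite e" "e \<inter> A = {}" using assms(1) finite_subset by blast+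
      then show "e \<subseteq> V \<and> A \<subseteq> V \<and> card (e \<union> A) = r"
        using e fA assms by (auto simp: card_Un_disjoint)
    qed
    show "(\<lambda>e. e - A) ` {e. e \<subseteq> V \<and> card e = r \<and> A \<subseteq> e} \<subseteq> {e. e \<subseteq> V - A \<and> card e = r - card A}"
      using fA by (auto simp: card_Diff_subset)
  qed auto
  then have "card {e. e \<subseteq> V \<and> card e = r \<and> A \<subseteq> e} = card {e. e \<subseteq> V - A \<and> card e = r - card A}"
    by (rule bij_betw_same_card[symmetric])
  also have "\<dots> = card (V - A) choose (r - card A)"
    using assms(1) by (intro n_subsets) auto
  finally show ?thesis using fA assms(2) by (simp add: card_Diff_subset)
qed

lemma card_edges_le_choose:
  assumes "rgraph r H"
  shows "card (edges H) \<le> card (verts H) choose r"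
proof -
  have fin: "finite (verts H)" using assms by (simp add: rgraph_def)
  have "card (edges H) \<le> card {e. e \<subseteq> verts H \<and> card e = r}"
    using assms fin by (intro card_mono) (auto simp: rgraph_def)
  then show ?thesis using n_subsets[OF fin] by simp
qed

lemma vdegree_le_choose:
  assumes "rgraph r H" "r \<ge> 1" "v \<in> verts H"
  shows "vdegree H v \<le> (card (verts H) - 1) choose (r - 1)"
proof -
  have fin: "finite (verts H)" using assms by (simp add: rgraph_def)
  have "vdegree H v \<le> card {e. e \<subseteq> verts H \<and> card e = r \<and> {v} \<subseteq> e}"
    unfolding vdegree_def using assms fin by (intro card_mono) (auto simp: rgraph_def)
  then show ?thesis using card_supersets[OF fin, of "{v}" r] assms by simp
qed

lemma codegree_le_choose:
  assumes "rgraph r H" "r \<ge> 2" "v \<in> verts H" "w \<in> verts H" "v \<noteq> w"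
  shows "card {e \<in> edges H. v \<in> e \<and> w \<in> e} \<le> (card (verts H) - 2) choose (r - 2)"
proof -
  have fin: "finite (verts H)" using assms by (simp add: rgraph_def)
  have "card {e \<in> edges H. v \<in> e \<and> w \<in> e} \<le> card {e. e \<subseteq> verts H \<and> card e = r \<and> {v, w} \<subseteq> e}"
    using assms fin by (intro card_mono) (auto simp: rgraph_def)
  then show ?thesis using card_supersets[OF fin, of "{v, w}" r] assms
    by (simp add: numeral_2_eq_2)
qed

lemma sum_vdegree:
  assumes "rgraph r H"
  shows "(\<Sum>v\<in>verts H. vdegree H v) = r * card (edges H)"
proof -
  have fin: "finite (verts H)" "finite (edges H)"
    using assms finite_edges by (auto simp: rgraph_def)
  have "(\<Sum>v\<in>verts H. vdegree H v) = (\<Sum>v\<in>verts H. card {e \<in> edges H. v \<in> e})"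
    by (simp add: vdegree_def)
  also have "\<dots> = (\<Sum>e\<in>edges H. card {v \<in> verts H. v \<in> e})"
    using fin sum_multicount_gen[OF fin(1,2), where R = "\<lambda>v e. v \<in> e"
      and k = "\<lambda>e. card {v \<in> verts H. v \<in> e}"] by auto
  also have "\<dots> = (\<Sum>e\<in>edges H. r)"
  proof (rule sum.cong)
    fix e assume "e \<in> edges H"
    then have "e \<subseteq> verts H" "card e = r" using assms by (auto simp: rgraph_def)
    moreover have "{v \<in> verts H. v \<in> e} = e" using \<open>e \<subseteq> verts H\<close> by auto
    ultimately show "card {v \<in> verts H. v \<in> e} = r" by simp
  qed simp
  finally show ?thesis by simp
qed

lemma avg_degree_eq:
  assumes "rgraph r H"
  shows "avg_degree H = real r * real (card (edges H)) / real (card (verts H))"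
  unfolding avg_degree_def of_nat_sum[symmetric] sum_vdegree[OF assms] by simp

text \<open>Every lost edge contains a vertex of \<open>W\<close>; an edge with several such
  vertices is counted several times, whence only an inequality.\<close>

lemma card_edges_delete_ge:
  assumes "rgraph r H" "finite W"
  shows "card (edges H) \<le> card (edges (delete H W)) + (\<Sum>v\<in>W. vdegree H v)"
proof -
  have fin: "finite (edges H)" using assms finite_edges by blast
  have "edges H \<subseteq> edges (delete H W) \<union> (\<Union>v\<in>W. {e \<in> edges H. v \<in> e})" by auto
  then have "card (edges H) \<le> card (edges (delete H W) \<union> (\<Union>v\<in>W. {e \<in> edges H. v \<in> e}))"
    using fin assms(2) by (intro card_mono) auto
  also have "\<dots> \<le> card (edges (delete H W)) + card (\<Union>v\<in>W. {e \<in> edges H. v \<in> e})"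
    by (rule card_Un_le)
  also have "card (\<Union>v\<in>W. {e \<in> edges H. v \<in> e}) \<le> (\<Sum>v\<in>W. card {e \<in> edges H. v \<in> e})"
    using assms(2) by (rule card_UN_le)
  finally show ?thesis by (simp add: vdegree_def)
qed

text \<open>An edge at \<open>v\<close> is lost only if it also contains some
  \<open>w \<in> W\<close>, and few edges pass through a given pair.\<close>

lemma vdegree_delete_ge:
  assumes "rgraph r H" "r \<ge> 2" "W \<subseteq> verts H" "v \<in> verts H" "v \<notin> W"
  shows "vdegree H v
           \<le> vdegree (delete H W) v + card W * ((card (verts H) - 2) choose (r - 2))"
proof -
  have fin: "finite (edges H)" "finite W"
    using assms finite_edges finite_subset by (auto simp: rgraph_def)
  let ?E = "\<lambda>w. {e \<in> edges H. v \<in> e \<and> w \<in> e}"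
  have "{e \<in> edges H. v \<in> e} \<subseteq> {e \<in> edges (delete H W). v \<in> e} \<union> (\<Union>w\<in>W. ?E w)"
    by auto
  then have "vdegree H v \<le> card ({e \<in> edges (delete H W). v \<in> e} \<union> (\<Union>w\<in>W. ?E w))"
    unfolding vdegree_def using fin by (intro card_mono) auto
  also have "\<dots> \<le> vdegree (delete H W) v + card (\<Union>w\<in>W. ?E w)"
    unfolding vdegree_def by (rule card_Un_le)
  also have "card (\<Union>w\<in>W. ?E w) \<le> (\<Sum>w\<in>W. card (?E w))"
    using fin(2) by (rule card_UN_le)
  also have "(\<Sum>w\<in>W. card (?E w)) \<le> (\<Sum>w\<in>W. (card (verts H) - 2) choose (r - 2))"
    using assms by (intro sum_mono codegree_le_choose) auto
  finally show ?thesis by simp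
qed

lemma card_edges_delete_vertex:
  assumes "rgraph r H"
  shows "card (edges H) = card (edges (delete H {v})) + vdegree H v"
proof -
  have "edges H = edges (delete H {v}) \<union> {e \<in> edges H. v \<in> e}"
    "edges (delete H {v}) \<inter> {e \<in> edges H. v \<in> e} = {}" by auto
  then show ?thesis unfolding vdegree_def
    using card_Un_disjoint[of "edges (delete H {v})" "{e \<in> edges H. v \<in> e}"] finite_edges[OF assms]
    by simp
qed

section \<open>Joins with a complete graph\<close>

text \<open>The join of \<open>H\<close> with the complete \<open>r\<close>-graph on
  \<open>S\<close>, for \<open>r > 0\<close>: edges inside \<open>S\<close> and edges crossing to
  \<open>H\<close> are merged into the one condition of meeting \<open>S\<close>.\<close>

definition cone :: "nat \<Rightarrow> 'a set \<Rightarrow> 'a hypergraph \<Rightarrow> 'a hypergraph" where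
  "cone r S H =
     \<lparr>verts = S \<union> verts H,
      edges = edges H \<union> {e. e \<subseteq> S \<union> verts H \<and> card e = r \<and> e \<inter> S \<noteq> {}}\<rparr>"

lemma verts_cone [simp]: "verts (cone r S H) = S \<union> verts H"
  and edges_cone: "edges (cone r S H) =
    edges H \<union> {e. e \<subseteq> S \<union> verts H \<and> card e = r \<and> e \<inter> S \<noteq> {}}"
  by (simp_all add: cone_def)

lemma rgraph_cone: "rgraph r H \<Longrightarrow> finite S \<Longrightarrow> rgraph r (cone r S H)"
  by (auto simp: rgraph_def edges_cone)

text \<open>The \<open>r\<close>-subsets of \<open>S \<union> verts H\<close> are those meeting
  \<open>S\<close> and those inside \<open>verts H\<close>. The additive form avoids truncated
  subtraction.\<close>

lemma card_edges_cone:
  assumes "rgraph r H" "finite S" "disjnt S (verts H)"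
  shows "card (edges (cone r S H)) + (card (verts H) choose r)
           = card (edges H) + (card (S \<union> verts H) choose r)"
proof -
  let ?X = "{e. e \<subseteq> S \<union> verts H \<and> card e = r \<and> e \<inter> S \<noteq> {}}"
  let ?Y = "{e. e \<subseteq> verts H \<and> card e = r}"
  have fin: "finite (verts H)" using assms by (simp add: rgraph_def)
  have finX: "finite ?X" "finite ?Y" using fin assms(2) by auto
  have "?X \<union> ?Y = {e. e \<subseteq> S \<union> verts H \<and> card e = r}" "?X \<inter> ?Y = {}"
    using assms(3) by (auto simp: disjnt_iff)
  then have "card ?X + card ?Y = card (S \<union> verts H) choose r"
    using card_Un_disjoint[OF finX] n_subsets[of "S \<union> verts H" r] fin assms(2) by simp
  moreover have "card ?Y = card (verts H) choose r" using n_subsets[OF fin] by simp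
  moreover have "edges H \<inter> ?X = {}"
    using assms by (auto simp: rgraph_def disjnt_iff)
  then have "card (edges (cone r S H)) = card (edges H) + card ?X"
    unfolding edges_cone using card_Un_disjoint finX finite_edges[OF assms(1)] by blast
  ultimately show ?thesis by simp
qed

text \<open>Each copy in a packing contains a vertex of \<open>S\<close>, since \<open>H\<close> is \<open>F\<close>-free.\<close>

lemma nu_cone_le:
  fixes H :: "'a hypergraph"
  assumes F: "rgraph r F" and H: "rgraph r H" "F_free F H" and S: "finite S"
  shows "nu F (cone r S H) \<le> card S"
proof -
  obtain M where M: "packing F (cone r S H) M" "card M = nu F (cone r S H)"
    using nu_packing[OF rgraph_cone[OF H(1) S]] .
  have meet: "\<exists>x. x \<in> verts G \<inter> S" if "G \<in> M" for G
  proof (rule ccontr)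
    assume disj: "\<nexists>x. x \<in> verts G \<inter> S"
    have G: "verts G \<subseteq> S \<union> verts H" "edges G \<subseteq> edges (cone r S H)" "isomorphic F G"
      using that M(1) by (auto simp: packing_def copies_def)
    have "rgraph r G" using isomorphic_rgraph(1)[OF F G(3)] .
    then have disj_e: "e \<inter> S = {}" if "e \<in> edges G" for e
      using that disj by (auto simp: rgraph_def)
    have "edges G \<subseteq> edges H"
    proof
      fix e assume "e \<in> edges G"
      then have "e \<in> edges (cone r S H)" "e \<inter> S = {}" using G(2) disj_e by auto
      then show "e \<in> edges H" by (simp add: edges_cone)
    qed
    moreover have "verts G \<subseteq> verts H" using G(1) disj by blast
    ultimately have "G \<in> copies F H" using G(3) by (simp add: copies_def)
    then show False using H copies_nonempty_iff F_free_iff by blast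
  qed
  define x where "x (G :: 'a hypergraph) = (SOME x. x \<in> verts G \<inter> S)" for G
  have x: "x G \<in> verts G \<inter> S" if "G \<in> M" for G
    unfolding x_def using meet[OF that] by (rule someI_ex)
  have "inj_on x M"
  proof (rule inj_onI, rule ccontr)
    fix G G' assume "G \<in> M" "G' \<in> M" "x G = x G'" "G \<noteq> G'"
    moreover from this have "disjnt (verts G) (verts G')"
      using M(1) by (auto simp: packing_def pairwise_def)
    ultimately show False using x[of G] x[of G'] by (auto simp: disjnt_iff)
  qed
  then have "card M \<le> card S" using x S by (intro card_inj_on_le[of x]) auto
  then show ?thesis using M(2) by simp
qed

lemma join_eq_cone:
  assumes "edges G = {e. e \<subseteq> verts G \<and> card e = r}" "rgraph r H" "r > 0"
  shows "join r G H = cone r (verts G) H"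
proof -
  have "e \<inter> verts G \<noteq> {}" if "e \<subseteq> verts G" "card e = r" for e
    using that assms(3) by (auto simp: Int_absorb2)
  then have "edges (join r G H) = edges (cone r (verts G) H)"
    unfolding join_def edges_cone using assms(1) by auto
  then show ?thesis by (simp add: join_def cone_def)
qed

text \<open>\<open>EX_fam\<close> is closed under isomorphism and a complete graph is determined by
  its vertex set, so the isomorphic copies in \<open>join_family\<close> collapse to a choice of
  \<open>S\<close> and \<open>H\<close>.\<close>

lemma join_family_complete:
  assumes "rgraph r F" "r > 0"
  shows "join_family r (complete_rgraph r t) (EX_fam r n F) =
    {cone r S H |S H. finite S \<and> card S = t \<and> disjnt S (verts H) \<and> H \<in> EX_fam r n F}"
    (is "?L = ?R")
proof
  show "?L \<subseteq> ?R"
  proof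
    fix J assume "J \<in> ?L"
    then obtain G H' H where J: "J = join r G H'" "isomorphic (complete_rgraph r t) G"
      "H \<in> EX_fam r n F" "isomorphic H H'" "disjnt (verts G) (verts H')"
      unfolding join_family_def by blast
    have "H' \<in> EX_fam r n F" using EX_fam_isomorphic assms J by blast
    moreover from this have "rgraph r H'" by (simp add: EX_fam_def)
    ultimately show "J \<in> ?R"
      using J join_eq_cone[of G r H'] assms(2) isomorphic_complete_iff[of r t G] by blast
  qed
  show "?R \<subseteq> ?L"
  proof
    fix J assume "J \<in> ?R"
    then obtain S H where J: "J = cone r S H" "finite S" "card S = t" "disjnt S (verts H)"
      "H \<in> EX_fam r n F" by blast
    define G where "G = \<lparr>verts = S, edges = {e. e \<subseteq> S \<and> card e = r}\<rparr>"
    have "rgraph r H" using J by (simp add: EX_fam_def)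
    then have "J = join r G H"
      using join_eq_cone[of G r H] assms(2) J by (simp add: G_def)
    moreover have "isomorphic (complete_rgraph r t) G"
      using J isomorphic_complete_iff[of r t G] by (simp add: G_def)
    moreover have "disjnt (verts G) (verts H)" using J by (simp add: G_def)
    ultimately show "J \<in> ?L" unfolding join_family_def using J isomorphic_refl by blast
  qed
qed

section \<open>The extremal function\<close>

text \<open>An edge in \<open>F\<close> gives \<open>r \<le> m\<close> and makes edgeless hosts
  \<open>F\<close>-free, so that \<open>ex_num\<close> is a maximum over a nonempty set.\<close>

locale turan =
  fixes r m :: nat and F :: "'b hypergraph"
  assumes r2: "r \<ge> 2" and F: "rgraph r F" and m: "card (verts F) = m"
    and edges_F: "edges F \<noteq> {}"
begin

lemma r_le_m: "r \<le> m"
proof -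
  obtain e where "e \<in> edges F" using edges_F by blast
  then show ?thesis using F m card_mono[of "verts F" e] by (auto simp: rgraph_def)
qed

lemma copy_verts:
  assumes "G \<in> copies F H"
  shows "card (verts G) = m" "finite (verts G)"
proof -
  have "isomorphic F G" using assms by (simp add: copies_def)
  from isomorphic_rgraph[OF F this] m
  show "card (verts G) = m" "finite (verts G)" by (auto simp: rgraph_def)
qed

lemma packing_verts:
  assumes "packing F H M"
  shows "card (\<Union>(verts ` M)) = m * card M"
    "\<Union>(verts ` M) \<subseteq> verts H"
proof -
  have M: "M \<subseteq> copies F H" "pairwise (\<lambda>G G'. disjnt (verts G) (verts G')) M"
    using assms by (auto simp: packing_def)
  show "\<Union>(verts ` M) \<subseteq> verts H" using M(1) by (auto simp: copies_def)
  have "0 < m" using r_le_m r2 by simp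
  \<comment> \<open>Two members with the same vertex set would make it disjoint from itself, hence
    empty, against \<open>m > 0\<close>.\<close>
  have inj: "inj_on verts M"
  proof (rule inj_onI, rule ccontr)
    fix G G' assume *: "G \<in> M" "G' \<in> M" "verts G = verts G'" "G \<noteq> G'"
    then have "disjnt (verts G) (verts G)" using M(2) by (metis pairwiseD)
    then have "verts G = {}" by (simp add: disjnt_def)
    then show False using copy_verts(1)[of G H] * M(1) \<open>0 < m\<close> by auto
  qed
  have "card (\<Union>(verts ` M)) = (\<Sum>A\<in>verts ` M. card A)"
  proof (rule card_Union_disjoint)
    show "pairwise disjnt (verts ` M)" using M(2) by (auto simp: pairwise_def)
    show "finite A" if "A \<in> verts ` M" for A using that M(1) copy_verts(2) by blast
  qed
  also have "\<dots> = (\<Sum>G\<in>M. card (verts G))" using inj by (simp add: sum.reindex)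
  also have "\<dots> = (\<Sum>G\<in>M. m)" using M(1) copy_verts(1) by (intro sum.cong) auto
  finally show "card (\<Union>(verts ` M)) = m * card M" by simp
qed

text \<open>A copy surviving the deletion would be disjoint from all members of \<open>M\<close> and
  extend it beyond \<open>nu F H\<close>.\<close>

lemma F_free_delete_packing:
  assumes H: "rgraph r H" and M: "packing F H M" "nu F H \<le> card M"
  shows "F_free F (delete H (\<Union>(verts ` M)))"
proof (rule ccontr)
  let ?W = "\<Union>(verts ` M)"
  assume "\<not> F_free F (delete H ?W)"
  then have "copies F (delete H ?W) \<noteq> {}"
    using F_free_iff[OF rgraph_delete[OF H]] copies_nonempty_iff by blast
  then obtain G where G: "G \<in> copies F (delete H ?W)" by blast
  have "verts G \<inter> ?W = {}" using G by (auto simp: copies_def)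
  moreover have "card (verts G) > 0" using copy_verts[OF G] r_le_m r2 by simp
  then have "verts G \<noteq> {}" by auto
  ultimately have "G \<notin> M" by blast
  have GH: "G \<in> copies F H" using G by (auto simp: copies_def)
  have disj: "disjnt (verts G) (verts G')" if "G' \<in> M" for G'
    using that \<open>verts G \<inter> ?W = {}\<close> by (auto simp: disjnt_def)
  then have "disjnt (verts G') (verts G)" if "G' \<in> M" for G'
    using that disjnt_sym by blast
  then have "packing F H (insert G M)"
    using M(1) GH disj unfolding packing_def pairwise_insert by simp
  moreover have "finite M"
    using M(1) finite_copies[OF H] finite_subset by (auto simp: packing_def)
  ultimately show False
    using card_packing_le_nu[OF H, of F "insert G M"] \<open>G \<notin> M\<close> M(2) by simp
qed

text \<open>The predicate \<open>P\<close> is left open to cover both maxima, over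
  \<open>F\<close>-free hosts and over hosts with bounded \<open>nu\<close>.\<close>

lemma finite_ex_set:
  "finite {card (edges H) |H :: nat hypergraph. rgraph r H \<and> card (verts H) = n \<and> P H}"
  by (rule finite_subset[of _ "{..n choose r}"]) (auto intro: card_edges_le_choose)

lemma card_edges_le_ex_num:
  assumes "rgraph r H" "card (verts H) = n" "F_free F H"
  shows "card (edges (H :: nat hypergraph)) \<le> ex_num r n F"
  unfolding ex_num_def using assms by (intro Max_ge finite_ex_set) auto

lemma EX_fam_nonempty: "\<exists>H. H \<in> EX_fam r n F"
proof -
  let ?H = "\<lparr>verts = {..<n}, edges = {}\<rparr> :: nat hypergraph"
  have "rgraph r ?H" by (simp add: rgraph_def)
  moreover from this have "F_free F ?H" using F_free_iff[of r ?H F] edges_F by (auto simp: embeds_def)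
  ultimately have "card (edges ?H) \<in>
    {card (edges H) |H :: nat hypergraph. rgraph r H \<and> card (verts H) = n \<and> F_free F H}"
    by force
  then have "ex_num r n F \<in>
    {card (edges H) |H :: nat hypergraph. rgraph r H \<and> card (verts H) = n \<and> F_free F H}"
    unfolding ex_num_def by (intro Max_in finite_ex_set) auto
  then show ?thesis by (auto simp: EX_fam_def)
qed

text \<open>Adding an isolated vertex creates no copy: since \<open>m \<le> n\<close>, its preimage, isolated
  in \<open>F\<close>, could be mapped to an unused vertex instead.\<close>

lemma ex_num_Suc_ge:
  assumes "m \<le> n"
  shows "ex_num r n F \<le> ex_num r (Suc n) F"
proof -
  obtain H :: "nat hypergraph" where H: "rgraph r H" "card (verts H) = n" "F_free F H"
    "card (edges H) = ex_num r n F"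
    using EX_fam_nonempty[of n] by (auto simp: EX_fam_def)
  have fin: "finite (verts H)" "finite (verts F)" using H(1) F by (auto simp: rgraph_def)
  obtain w where w: "w \<notin> verts H" using ex_new_if_finite[OF infinite_UNIV_nat fin(1)] by blast
  define H' where "H' = \<lparr>verts = insert w (verts H), edges = edges H\<rparr>"
  have H': "rgraph r H'" "card (verts H') = Suc n"
    using H(1,2) fin w by (auto simp: rgraph_def H'_def)
  have "\<not> embeds F H'"
  proof
    assume "embeds F H'"
    then obtain f where f: "inj_on f (verts F)" "f ` verts F \<subseteq> insert w (verts H)"
      "\<forall>e\<in>edges F. f ` e \<in> edges H" by (auto simp: embeds_def H'_def)
    have "embeds F H"
    proof (cases "w \<in> f ` verts F")
      case False
      then show ?thesis using f unfolding embeds_def by blast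
    next
      case True
      then obtain x where x: "x \<in> verts F" "f x = w" by blast
      have sub: "f ` (verts F - {x}) \<subseteq> verts H"
        using f(1,2) x by (auto simp: inj_on_def)
      have "card (f ` (verts F - {x})) < card (verts H)"
      proof -
        have "card (f ` (verts F - {x})) \<le> card (verts F - {x})"
          using fin(2) by (intro card_image_le) auto
        also have "\<dots> < card (verts F)" using x(1) fin(2) by (intro card_Diff1_less)
        finally show ?thesis using m assms H(2) by simp
      qed
      then have "\<not> verts H \<subseteq> f ` (verts F - {x})"
        using card_mono[of "f ` (verts F - {x})" "verts H"] fin(2) by auto
      then obtain u where u: "u \<in> verts H" "u \<notin> f ` (verts F - {x})" by blast
      have "x \<notin> e" if "e \<in> edges F" for e
      proof -
        have "f ` e \<subseteq> verts H" using that f(3) H(1) by (simp add: rgraph_def)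
        then show ?thesis using x(2) w by blast
      qed
      then have "(f(x := u)) ` e = f ` e" if "e \<in> edges F" for e
        using that by (intro image_cong) auto
      moreover have "inj_on (f(x := u)) (verts F)"
        using f(1) u(2) by (auto simp: inj_on_def)
      moreover have "(f(x := u)) ` verts F \<subseteq> verts H"
        using sub u(1) by auto
      ultimately show ?thesis using f(3) unfolding embeds_def by (intro exI[of _ "f(x := u)"]) simp
    qed
    then show False using F_free_iff H by blast
  qed
  then have "F_free F H'" using F_free_iff H'(1) by blast
  from card_edges_le_ex_num[OF H' this] show ?thesis using H(4) by (simp add: H'_def)
qed

lemma ex_num_mono:
  assumes "m \<le> k" "k \<le> n"
  shows "ex_num r k F \<le> ex_num r n F"
  using assms(2,1)
proof (induction rule: dec_induct)
  case (step n)
  then show ?case using ex_num_Suc_ge[of n] by simp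
qed simp

text \<open>Averaging over all vertex-deleted subgraphs.\<close>

lemma ex_num_ratio: "(Suc n - r) * ex_num r (Suc n) F \<le> Suc n * ex_num r n F"
proof (cases "r \<le> Suc n")
  case True
  obtain H :: "nat hypergraph" where H: "rgraph r H" "card (verts H) = Suc n" "F_free F H"
    "card (edges H) = ex_num r (Suc n) F"
    using EX_fam_nonempty[of "Suc n"] by (auto simp: EX_fam_def)
  have fin: "finite (verts H)" using H(1) by (auto simp: rgraph_def)
  have "card (edges (delete H {v})) \<le> ex_num r n F" if "v \<in> verts H" for v
  proof (rule card_edges_le_ex_num)
    have eq: "delete H {} = H" by (rule hypergraph.equality) auto
    show "F_free F (delete H {v})"
      by (rule F_free_delete_mono[OF H(1), of F "{}"]) (use H(3) in \<open>simp_all only: eq empty_subsetI\<close>)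
  qed (use H fin that rgraph_delete in auto)
  then have "card (edges H) \<le> ex_num r n F + vdegree H v" if "v \<in> verts H" for v
    using that card_edges_delete_vertex[OF H(1), of v] by fastforce
  then have "(\<Sum>v\<in>verts H. card (edges H)) \<le> (\<Sum>v\<in>verts H. ex_num r n F + vdegree H v)"
    by (intro sum_mono)
  then have "Suc n * card (edges H) \<le> Suc n * ex_num r n F + r * card (edges H)"
    using sum_vdegree[OF H(1)] H(2) by (simp add: sum.distrib)
  then show ?thesis using H(4) by (simp add: diff_mult_distrib)
qed simp

text \<open>By \<open>ex_num_ratio\<close> the ratios do not increase from \<open>n = r\<close> on,
  and they are nonnegative. Convergence makes the \<open>lim\<close> in \<open>turan_density\<close>
  an actual limit.\<close>

lemma convergent_ex_ratio: "convergent (\<lambda>n. real (ex_num r n F) / real (n choose r))"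
proof -
  let ?a = "\<lambda>n. real (ex_num r n F) / real (n choose r)"
  have step: "?a (Suc n) \<le> ?a n" if "r \<le> n" for n
  proof -
    have pos: "real (n choose r) > 0" "real (Suc n choose r) > 0" "real (Suc n - r) > 0"
      using that by auto
    \<comment> \<open>Absorption produces the same factors \<open>Suc n - r\<close> and
      \<open>Suc n\<close> as \<open>ex_num_ratio\<close>, so they cancel.\<close>
    have "(Suc n - r) * (Suc n choose r) = Suc n * (n choose r)"
      using binomial_absorb_comp[of "Suc n" r] by simp
    then have eq: "real (Suc n - r) * real (Suc n choose r) = real (Suc n) * real (n choose r)"
      by (metis of_nat_mult)
    have "real (Suc n - r) * real (ex_num r (Suc n) F) \<le> real (Suc n) * real (ex_num r n F)"
      using ex_num_ratio[of n] by (metis of_nat_le_iff of_nat_mult)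
    then have "real (Suc n - r) * real (ex_num r (Suc n) F) * real (n choose r)
        \<le> real (Suc n) * real (ex_num r n F) * real (n choose r)"
      by (rule mult_right_mono) simp
    also have "\<dots> = real (Suc n - r) * (real (ex_num r n F) * real (Suc n choose r))"
      using eq by (metis mult.assoc mult.commute)
    finally have "real (ex_num r (Suc n) F) * real (n choose r)
        \<le> real (ex_num r n F) * real (Suc n choose r)"
      using pos(3) by (simp only: mult.assoc mult_le_cancel_left_pos)
    then show ?thesis using pos by (simp add: divide_simps)
  qed
  have "decseq (\<lambda>n. ?a (n + r))"
    by (rule decseq_SucI) (use step in auto)
  then have "convergent (\<lambda>n. ?a (n + r))"
    by (rule decseq_convergent[where B = 0]) (auto simp: convergent_def)
  then show ?thesis using convergent_ignore_initial_segment[of ?a r] by simp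
qed


section \<open>Deleting \<open>m t\<close> vertices to destroy all copies of
  \<open>F\<close>\<close>

lemma F_free_delete_transversal:
  assumes H: "rgraph r H" "nu F H \<le> t" "m * t \<le> card (verts H)"
  obtains W where "W \<subseteq> verts H" "card W = m * t" "F_free F (delete H W)"
proof -
  obtain M where M: "packing F H M" "card M = nu F H" using nu_packing[OF H(1)] .
  let ?W = "\<Union>(verts ` M)"
  have fin: "finite (verts H)" using H(1) by (simp add: rgraph_def)
  have "card ?W \<le> m * t" using packing_verts(1)[OF M(1)] M(2) H(2) by simp
  \<comment> \<open>Padding to exactly \<open>m t\<close> vertices keeps the remaining order equal
    to \<open>n - m t\<close> even if \<open>nu F H < t\<close>.\<close>
  then obtain W where W: "?W \<subseteq> W" "W \<subseteq> verts H" "card W = m * t"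
    using exists_subset_between[of ?W "m * t" "verts H"] H(3) packing_verts(2)[OF M(1)] fin by auto
  have "F_free F (delete H ?W)" using F_free_delete_packing[OF H(1) M(1)] M(2) by simp
  then show ?thesis using that[OF W(2,3)] F_free_delete_mono[OF H(1) _ W(1)] by blast
qed

text \<open>\<open>t\<close> disjoint copies in \<open>H - v\<close> form a maximum packing of
  \<open>H\<close> itself, so their vertex set meets every copy while missing
  \<open>v\<close>.\<close>

lemma F_free_delete_avoiding:
  assumes H: "rgraph r H" "nu F H \<le> t" "t \<le> nu F (delete H {v})"
  obtains W where "W \<subseteq> verts H - {v}" "card W = m * t" "F_free F (delete H W)"
proof -
  obtain M where M: "packing F (delete H {v}) M" "card M = nu F (delete H {v})"
    using nu_packing[OF rgraph_delete[OF H(1)]] .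
  have MH: "packing F H M" by (rule packing_mono[OF M(1)]) auto
  have "card M \<le> t" using card_packing_le_nu[OF H(1) MH] H(2) by simp
  then have cM: "card M = t" using M(2) H(3) by simp
  have "F_free F (delete H (\<Union>(verts ` M)))"
    using F_free_delete_packing[OF H(1) MH] cM H(2) by simp
  then show ?thesis
    using that[of "\<Union>(verts ` M)"] packing_verts(1,2)[OF M(1)] cM by simp
qed

end

section \<open>Estimates for binomial coefficients\<close>

text \<open>By Pascal's rule each of the \<open>t\<close> added elements contributes at least
  \<open>a choose k\<close> new sets.\<close>

lemma choose_add_ge: "(a choose Suc k) + t * (a choose k) \<le> (a + t) choose Suc k"
proof (induction t)
  case (Suc t)
  have "a choose k \<le> (a + t) choose k" by (rule binomial_right_mono) simp
  then show ?case using Suc by simp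
qed simp

lemma choose_le_diff:
  assumes "s \<le> n"
  shows "n choose Suc k \<le> ((n - s) choose Suc k) + s * ((n - 1) choose k)"
  using assms
proof (induction s)
  case (Suc s)
  then obtain a where a: "n - s = Suc a" "n - Suc s = a" by (metis Suc_diff_Suc Suc_le_lessD)
  have "a choose k \<le> (n - 1) choose k" using a Suc.prems by (intro binomial_right_mono) simp
  then show ?case using Suc a by simp
qed simp

text \<open>A Bernoulli-type estimate: by absorption the loss
  \<open>s * ((n - 1) choose (k - 1))\<close> from \<open>choose_le_diff\<close> is the fraction
  \<open>s k / n\<close> of \<open>n choose k\<close>.\<close>

lemma choose_diff_ge:
  assumes "s \<le> n" "n > 0"
  shows "(1 - real s * real k / real n) * real (n choose k) \<le> real ((n - s) choose k)"
proof (cases k)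
  case (Suc j)
  have "k * (n choose k) = n * ((n - 1) choose j)"
    using times_binomial_minus1_eq[of k n] Suc by simp
  then have "real k * real (n choose k) = real n * real ((n - 1) choose j)"
    by (metis of_nat_mult)
  then have "real s * real k / real n * real (n choose k) = real s * real ((n - 1) choose j)"
    using assms(2) by (simp add: field_simps)
  moreover have "real (n choose k) \<le> real ((n - s) choose k) + real s * real ((n - 1) choose j)"
    using choose_le_diff[OF assms(1), of j] Suc by (metis of_nat_add of_nat_le_iff of_nat_mult)
  ultimately show ?thesis by (simp add: left_diff_distrib)
qed simp

text \<open>Closing arithmetic of \<open>vertex_of_large_degree\<close>: \<open>C\<close> and
  \<open>A\<close> will be \<open>n choose (r - 1)\<close> and
  \<open>(n - t) choose (r - 1)\<close>, \<open>d\<close> the extremal average degree after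
  deletion, and \<open>x = m t / n\<close>. In units of \<open>q C / 128\<close> the gap
  \<open>A - d\<close> is at least 111, while all error terms together are at most 51.\<close>

lemma degree_budget_contradiction:
  fixes C d q x A t m r :: real
  assumes "0 < q" "q < 1" "0 < C" "0 \<le> d" "d \<le> (1 - 7 * q / 8) * C" "1 \<le> t" "2 \<le> m" "2 \<le> r"
    and x: "0 \<le> x" "x * r \<le> q / (64 * m)" and A: "(1 - x * r) * C \<le> A"
    and le: "t * A + (m - 1) * t * (d * (1 - x) - q / (8 * m) * C)
               \<le> m * t * (d + q / (4 * m) * C + q / (64 * m) * C)"
  shows False
proof -
  \<comment> \<open>Naming the products leaves a linear problem after division by \<open>t\<close>.
    \<open>P\<close> comes from the factor \<open>1 - x\<close>, \<open>K\<close> from the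
    smoothness slack.\<close>
  define P where "P = (m - 1) * (d * x)"
  define K where "K = (m - 1) * (q / (8 * m) * C)"
  define Q where "Q = q * C"
  define M where "M = m * d"
  have "t * (A + (m - 1) * (d * (1 - x) - q / (8 * m) * C))
      \<le> t * (m * (d + q / (4 * m) * C + q / (64 * m) * C))"
    using le by (simp only: ring_distribs mult_ac)
  then have "A + (m - 1) * (d * (1 - x) - q / (8 * m) * C)
      \<le> m * (d + q / (4 * m) * C + q / (64 * m) * C)"
    using assms(6) by (simp add: mult_le_cancel_left)
  moreover have "m * (d + q / (4 * m) * C + q / (64 * m) * C) = M + Q / 4 + Q / 64"
    using assms(7) by (simp add: M_def Q_def field_simps)
  moreover have "(m - 1) * (d * (1 - x) - q / (8 * m) * C) = M - d - P - K"
    by (simp only: M_def P_def K_def ring_distribs mult_ac mult_1_left mult_1_right)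
  ultimately have budget: "A + (M - d - P - K) \<le> M + Q / 4 + Q / 64" by simp
  have "K = Q / 8 * ((m - 1) / m)"
    by (simp add: K_def Q_def field_simps)
  also have "\<dots> \<le> Q / 8 * 1" using assms by (intro mult_left_mono) (auto simp: Q_def)
  finally have K: "K \<le> Q / 8" by simp
  have "m * (x * 2) \<le> m * (x * r)" using assms by (intro mult_left_mono) auto
  also have "\<dots> \<le> m * (q / (64 * m))" using assms by (intro mult_left_mono) auto
  finally have "m * x \<le> q / 128" using assms(7) by simp
  then have mx: "(m - 1) * x \<le> q / 128" using x(1) by (simp add: algebra_simps)
  have d: "d \<le> C - 7 * Q / 8" using assms(5) by (simp add: Q_def algebra_simps)
  have Q: "0 < Q" using assms by (simp add: Q_def)
  have "(m - 1) * x * d \<le> q / 128 * C"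
    using mx d Q assms by (intro mult_mono) auto
  then have P: "P \<le> Q / 128" by (simp add: P_def Q_def mult_ac)
  have "q / (64 * m) \<le> q / 128" using assms by (intro divide_left_mono) auto
  then have "(1 - q / 128) * C \<le> (1 - x * r) * C"
    using x assms(3) by (intro mult_right_mono) auto
  then have "C - Q / 128 \<le> A" using A by (simp add: Q_def algebra_simps)
  then show False using budget K P d Q by linarith
qed

section \<open>A vertex of large degree\<close>

text \<open>Here \<open>q\<close> stands for \<open>1 - \<pi>(F)\<close>, so \<open>q < 1\<close> is
  nondegeneracy. In \<open>density\<close> the limiting value \<open>1 - q\<close> is relaxed by
  \<open>q / 8\<close>; its premise \<open>q > 0\<close> follows from \<open>eps_q\<close> once
  \<open>1 \<le> t \<le> \<epsilon> n\<close>.\<close>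

locale turan_smooth = turan r m F for r m and F :: "'b hypergraph" +
  fixes c q \<epsilon> :: real and N :: nat
  assumes c_pos: "c > 0" and q_less: "q < 1" and m_le_N: "m \<le> N"
    and eps_c: "\<epsilon> \<le> c / (4 * exp 1 * real r * real m)"
    and eps_q: "\<epsilon> \<le> q / (64 * real r * (real m)\<^sup>2)"
    and bounded: "j \<ge> N \<Longrightarrow>
      bounded_at r F j (c * real (j choose (r - 1))) (q / (4 * real m) * real (j choose (r - 1)))"
    and smooth: "j \<ge> N \<Longrightarrow> smooth_at r F j (q / (8 * real m) * real (j choose (r - 1)))"
    and density: "q > 0 \<Longrightarrow> j \<ge> N \<Longrightarrow>
      real (ex_num r j F) \<le> (1 - 7 * q / 8) * real (j choose r)"
begin

lemma m2: "m \<ge> 2"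
  using r_le_m r2 by simp

text \<open>Smoothness is summed: a step from \<open>j\<close> to \<open>j + 1\<close> gains about
  \<open>ex_avg_deg r j F\<close>. Monotonicity of \<open>ex_num\<close> and
  \<open>j \<le> n\<close> bound this below uniformly, at the price of the factor
  \<open>k / n\<close>.\<close>

lemma ex_num_add_ge:
  assumes "k \<ge> N" "k + s \<le> n" "q > 0"
  shows "real (ex_num r k F) + real s *
      (ex_avg_deg r k F * (real k / real n) - q / (8 * real m) * real (n choose (r - 1)))
    \<le> real (ex_num r (k + s) F)"
  using assms(2)
proof (induction s)
  case (Suc s)
  have pos: "k > 0" using assms(1) m_le_N m2 by simp
  have "real r * real (ex_num r k F) / real n \<le> real r * real (ex_num r (k + s) F) / real (k + s)"
    using Suc.prems pos ex_num_mono[of k "k + s"] assms(1) m_le_N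
    by (intro frac_le mult_left_mono) auto
  then have d: "ex_avg_deg r k F * (real k / real n) \<le> ex_avg_deg r (k + s) F"
    using pos by (simp add: ex_avg_deg_def)
  have "(k + Suc s) choose (r - 1) \<le> n choose (r - 1)"
    using Suc.prems by (intro binomial_right_mono) simp
  then have "q / (8 * real m) * real ((k + Suc s) choose (r - 1))
      \<le> q / (8 * real m) * real (n choose (r - 1))"
    using assms(3) by (intro mult_left_mono) auto
  moreover have "ex_avg_deg r (k + s) F - q / (8 * real m) * real ((k + Suc s) choose (r - 1))
      \<le> real (ex_num r (k + Suc s) F) - real (ex_num r (k + s) F)"
    using smooth[of "k + Suc s"] assms(1) by (simp add: smooth_at_def ex_diff_def)
  moreover have "real (Suc s) * X = real s * X + X" for X by (simp add: algebra_simps)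
  ultimately show ?case using Suc d by simp
qed simp

lemma vertex_of_large_degree:
  fixes H :: "nat hypergraph"
  assumes t: "t \<ge> 1" "N + m * t \<le> n" "real t \<le> \<epsilon> * real n"
    and H: "rgraph r H" "card (verts H) = n" "nu F H \<le> t"
    and edges_ge: "real (n choose r) - real ((n - t) choose r) + real (ex_num r (n - t) F)
           \<le> real (card (edges H))"
  shows "\<exists>v\<in>verts H. nu F (delete H {v}) < t"
proof (rule ccontr)
  assume "\<not> ?thesis"
  then have avoid: "t \<le> nu F (delete H {v})" if "v \<in> verts H" for v using that by force
  define k where "k = n - m * t"
  define x where "x = real (m * t) / real n"
  define C where "C = real (n choose (r - 1))"
  define C' where "C' = real (k choose (r - 1))"
  define d where "d = ex_avg_deg r k F"
  \<comment> \<open>Extremal average degree on \<open>k\<close> vertices, plus the slack of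
    boundedness, plus the edges at a vertex lost in deleting \<open>m t\<close> others.\<close>
  define D where "D = d + q / (4 * real m) * C + q / (64 * real m) * C"
  have fin: "finite (verts H)" using H(1) by (simp add: rgraph_def)
  have mt: "m * t \<le> n" "t \<le> m * t" using t m2 by auto
  have k: "k \<ge> N" "k + m * t = n" "k > 0" "n > 0"
    using t m_le_N m2 by (auto simp: k_def)
  have r1: "r - 1 \<le> k" "real (r - 1) = real r - 1" "r - 1 = Suc (r - 2)"
    using k m_le_N r_le_m r2 by auto
  have Cpos: "C > 0" using r1 k by (simp add: C_def)
  have C'C: "C' \<le> C" unfolding C_def C'_def using k by (simp add: binomial_right_mono)
  have t_q: "real t \<le> q / (64 * real r * (real m)\<^sup>2) * real n"
    using t(3) mult_right_mono[OF eps_q, of "real n"] by simp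
  have t_c: "real t \<le> c / (4 * exp 1 * real r * real m) * real n"
    using t(3) mult_right_mono[OF eps_c, of "real n"] by simp
  \<comment> \<open>\<open>t \<ge> 1\<close> is bounded by a nonnegative multiple of
    \<open>q\<close>.\<close>
  have q: "q > 0"
  proof (rule ccontr)
    assume "\<not> q > 0"
    then have "q / (64 * real r * (real m)\<^sup>2) * real n \<le> 0"
      by (intro mult_nonpos_nonneg divide_nonpos_nonneg) auto
    then show False using t_q t(1) by simp
  qed
  have x0: "x \<ge> 0" by (simp add: x_def)
  have xr: "x * real r \<le> q / (64 * real m)"
  proof -
    have "real t * (real m * real r / real n)
        \<le> q / (64 * real r * (real m)\<^sup>2) * real n * (real m * real r / real n)"
      by (intro mult_right_mono t_q) auto
    also have "\<dots> = q / (64 * real m)"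
      using k r2 m2 by (simp add: field_simps power2_eq_square)
    finally show ?thesis by (simp add: x_def mult_ac)
  qed
  have "q / (64 * real m) \<le> 1 / 128"
    using q_less q m2 by (simp add: divide_simps)
  then have xr': "x * real r \<le> 1 / 128" using xr by simp
  have "x * 2 \<le> x * real r" using x0 r2 by (intro mult_left_mono) auto
  then have x_half: "x \<le> 1 / 2" using xr' by simp
  have kn: "real k = (1 - x) * real n"
    using k(4) arg_cong[OF k(2), of real] by (simp add: x_def left_diff_distrib)
  have xr1: "x * real (r - 1) \<le> x * real r" using x0 by (intro mult_left_mono) auto
  \<comment> \<open>Boundedness is available with \<open>C'\<close>, the budget is kept in
    \<open>C\<close>; the two differ by a factor of at most 2.\<close>
  have "(1 - x * real (r - 1)) * C \<le> C'"
    using choose_diff_ge[of "m * t" n "r - 1"] mt k(4)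
    by (simp add: C_def C'_def k_def x_def)
  moreover have "1 / 2 * C \<le> (1 - x * real (r - 1)) * C"
    using xr1 xr' Cpos by (intro mult_right_mono) auto
  ultimately have C_le: "C \<le> 2 * C'" by simp

  \<comment> \<open>A weak form of \<open>edges_ge\<close>, enough to see that deleting
    \<open>m t\<close> vertices leaves nearly \<open>ex_num r k F\<close> edges.\<close>
  have H_ge: "ex_num r k F \<le> card (edges H)"
  proof -
    have "(n - t) choose r \<le> n choose r" by (rule binomial_right_mono) simp
    then have "real (ex_num r (n - t) F) \<le> real (card (edges H))" using edges_ge by linarith
    moreover have "ex_num r k F \<le> ex_num r (n - t) F"
      using diff_le_mono2[OF mt(2), of n] m_le_N k(1) by (intro ex_num_mono) (auto simp: k_def)
    ultimately show ?thesis by linarith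
  qed

  have degree_le: "real (vdegree H v) \<le> D" if v: "v \<in> verts H" for v
  proof -
    obtain W where W: "W \<subseteq> verts H - {v}" "card W = m * t" "F_free F (delete H W)"
      using F_free_delete_avoiding[OF H(1,3) avoid[OF v]] .
    have W': "finite W" "W \<subseteq> verts H" "v \<notin> W" using W(1) fin finite_subset by auto
    let ?H = "delete H W"
    have rH: "rgraph r ?H" using H(1) by (rule rgraph_delete)
    have cH: "card (verts ?H) = k" using W' W(2) H(2) by (simp add: card_Diff_subset k_def)
    \<comment> \<open>Trivial degree bounds suffice here: the resulting drop of the average degree
      only has to stay within the allowance \<open>c C'\<close>.\<close>
    have "(\<Sum>w\<in>W. vdegree H w) \<le> (\<Sum>w\<in>W. n choose (r - 1))"
    proof (rule sum_mono)
      fix w assume "w \<in> W"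
      then have "vdegree H w \<le> (n - 1) choose (r - 1)"
        using vdegree_le_choose[OF H(1), of w] W' r2 H(2) by auto
      also have "\<dots> \<le> n choose (r - 1)" by (rule binomial_right_mono) simp
      finally show "vdegree H w \<le> n choose (r - 1)" .
    qed
    then have "ex_num r k F \<le> card (edges ?H) + m * t * (n choose (r - 1))"
      using card_edges_delete_ge[OF H(1) W'(1)] H_ge W(2) by simp
    then have "real (ex_num r k F) \<le> real (card (edges ?H)) + real (m * t) * C"
      unfolding C_def by (metis of_nat_add of_nat_le_iff of_nat_mult)
    then have "real r * (real (ex_num r k F) - real (m * t) * C) / real k
        \<le> real r * real (card (edges ?H)) / real k"
      by (intro divide_right_mono mult_left_mono) auto
    then have "d - real r * real (m * t) * C / real k \<le> avg_degree ?H"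
      unfolding avg_degree_eq[OF rH] cH d_def ex_avg_deg_def
      by (simp add: algebra_simps diff_divide_distrib)
    \<comment> \<open>\<open>t_c\<close> and \<open>exp 1 \<ge> 1\<close> give
      \<open>r m t \<le> c n / 4\<close>; then \<open>n \<le> 2 k\<close> and
      \<open>C \<le> 2 C'\<close> finish.\<close>
    moreover have "real r * real (m * t) * C / real k \<le> c * C'"
    proof -
      have "real t * (real r * real m)
          \<le> c / (4 * exp 1 * real r * real m) * real n * (real r * real m)"
        by (intro mult_right_mono t_c) auto
      also have "\<dots> = c / (4 * exp 1) * real n" using r2 m2 by (simp add: field_simps)
      also have "\<dots> \<le> c / 4 * real n"
        using c_pos by (intro mult_right_mono divide_left_mono) (auto intro: order_trans)
      also have "\<dots> \<le> c / 4 * (2 * real k)"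
      proof -
        have "1 / 2 * real n \<le> (1 - x) * real n" using x_half by (intro mult_right_mono) auto
        then show ?thesis using kn c_pos by (intro mult_left_mono) auto
      qed
      finally have rmt: "real r * real (m * t) \<le> c / 2 * real k" by (simp add: mult_ac)
      have "real r * real (m * t) * C / real k \<le> c / 2 * real k * C / real k"
        using Cpos rmt by (intro divide_right_mono mult_right_mono) auto
      also have "\<dots> = c / 2 * C" using k by simp
      also have "\<dots> \<le> c / 2 * (2 * C')" using C_le c_pos by (intro mult_left_mono) auto
      finally show ?thesis by simp
    qed
    ultimately have "ex_avg_deg r k F - c * C' \<le> avg_degree ?H" by (simp add: d_def)
    then have "real (max_degree ?H) \<le> d + q / (4 * real m) * C'"
      using bounded[OF k(1)] rH cH W(3) by (auto simp: bounded_at_def C'_def d_def)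
    moreover have "real (vdegree ?H v) \<le> real (max_degree ?H)"
      unfolding max_degree_def using v W' fin by (intro of_nat_mono Max_ge) auto
    moreover have "q / (4 * real m) * C' \<le> q / (4 * real m) * C"
      using C'C q by (intro mult_left_mono) auto
    \<comment> \<open>An edge lost at \<open>v\<close> contains one of \<open>m t\<close> pairs
      through \<open>v\<close>; absorption turns \<open>m t * ((n - 1) choose (r - 2))\<close> into
      \<open>x (r - 1) C\<close>.\<close>
    moreover have "real (vdegree H v) \<le> real (vdegree ?H v) + q / (64 * real m) * C"
    proof -
      have "vdegree H v \<le> vdegree ?H v + m * t * ((n - 2) choose (r - 2))"
        using vdegree_delete_ge[OF H(1) r2 W'(2) v W'(3)] W(2) H(2) by simp
      also have "(n - 2) choose (r - 2) \<le> (n - 1) choose (r - 2)" by (rule binomial_right_mono) simp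
      finally have "vdegree H v \<le> vdegree ?H v + m * t * ((n - 1) choose (r - 2))" by simp
      then have "real (vdegree H v) \<le> real (vdegree ?H v) + real (m * t) * real ((n - 1) choose (r - 2))"
        by (metis of_nat_add of_nat_le_iff of_nat_mult)
      moreover have "(r - 1) * (n choose (r - 1)) = n * ((n - 1) choose (r - 2))"
        using times_binomial_minus1_eq[of "r - 1" n] r2 by (simp add: numeral_2_eq_2)
      then have "real (r - 1) * C = real n * real ((n - 1) choose (r - 2))"
        unfolding C_def by (metis of_nat_mult)
      then have "real (m * t) * real ((n - 1) choose (r - 2)) = x * real (r - 1) * C"
        using k by (simp add: x_def field_simps)
      moreover have "x * real (r - 1) * C \<le> q / (64 * real m) * C"
        using xr xr1 Cpos by (intro mult_right_mono) auto
      ultimately show ?thesis by simp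
    qed
    ultimately show ?thesis unfolding D_def by linarith
  qed

  \<comment> \<open>This time one set \<open>W\<close> serves for all of \<open>H\<close>, and its
    degrees are bounded by \<open>D\<close> instead of trivially.\<close>
  obtain W where W: "W \<subseteq> verts H" "card W = m * t" "F_free F (delete H W)"
    using F_free_delete_transversal[OF H(1,3)] mt H(2) by auto
  have finW: "finite W" using W(1) fin finite_subset by auto
  have "card (verts (delete H W)) = k" using W finW H(2) by (simp add: card_Diff_subset k_def)
  from card_edges_le_ex_num[OF rgraph_delete[OF H(1)] this W(3)]
  have "card (edges H) \<le> ex_num r k F + (\<Sum>v\<in>W. vdegree H v)"
    using card_edges_delete_ge[OF H(1) finW] by simp
  then have "real (card (edges H)) \<le> real (ex_num r k F) + (\<Sum>v\<in>W. real (vdegree H v))"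
    by (metis of_nat_add of_nat_le_iff of_nat_sum)
  also have "(\<Sum>v\<in>W. real (vdegree H v)) \<le> (\<Sum>v\<in>W. D)"
    using degree_le W(1) by (intro sum_mono) auto
  finally have H_le: "real (card (edges H)) \<le> real (ex_num r k F) + real (m * t) * D"
    using W(2) by simp

  define A where "A = real ((n - t) choose (r - 1))"
  \<comment> \<open>Of the \<open>m t\<close> deleted vertices, \<open>t\<close> are charged to the
    complete part, gaining at least \<open>A\<close> each, and the other \<open>(m - 1) t\<close> to
    the growth of \<open>ex_num\<close> from \<open>k\<close> to \<open>n - t\<close>.\<close>
  have "n - t = k + (m - 1) * t" "k + (m - 1) * t \<le> n"
    using k(2) m2 by (auto simp: k_def diff_mult_distrib)
  moreover have "real k / real n = 1 - x" using kn k by simp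
  ultimately have growth: "real (ex_num r k F) + real ((m - 1) * t) * (d * (1 - x) - q / (8 * real m) * C)
      \<le> real (ex_num r (n - t) F)"
    using ex_num_add_ge[OF k(1), of "(m - 1) * t" n] q by (simp add: d_def C_def)
  have "((n - t) choose r) + t * ((n - t) choose (r - 1)) \<le> n choose r"
    using choose_add_ge[of "n - t" "r - 1" t] mt r2 by simp
  then have lower: "real ((n - t) choose r) + real t * A \<le> real (n choose r)"
    unfolding A_def by (metis of_nat_add of_nat_le_iff of_nat_mult)
  have "real t * A + real ((m - 1) * t) * (d * (1 - x) - q / (8 * real m) * C) \<le> real (m * t) * D"
    using lower growth edges_ge H_le by linarith
  then have le: "real t * A + (real m - 1) * real t * (d * (1 - x) - q / (8 * real m) * C)
      \<le> real m * real t * (d + q / (4 * real m) * C + q / (64 * real m) * C)"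
    using m2 by (simp add: D_def of_nat_diff)

  have d0: "0 \<le> d" by (simp add: d_def ex_avg_deg_def)
  \<comment> \<open>Density becomes a degree bound through
    \<open>r * (k choose r) = k * ((k - 1) choose (r - 1))\<close>.\<close>
  have d_le: "d \<le> (1 - 7 * q / 8) * C"
  proof -
    have nn: "0 \<le> 1 - 7 * q / 8" using q_less by simp
    have "real r * real (ex_num r k F) \<le> real r * ((1 - 7 * q / 8) * real (k choose r))"
      using density[OF q k(1)] by (intro mult_left_mono) auto
    also have "\<dots> = (1 - 7 * q / 8) * real (r * (k choose r))" by simp
    also have "r * (k choose r) = k * ((k - 1) choose (r - 1))"
      using times_binomial_minus1_eq[of r k] r2 by simp
    also have "(1 - 7 * q / 8) * real (k * ((k - 1) choose (r - 1))) \<le> (1 - 7 * q / 8) * real (k * (n choose (r - 1)))"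
      using nn k by (intro mult_left_mono of_nat_mono mult_le_mono2 binomial_right_mono) auto
    finally have "real r * real (ex_num r k F) \<le> (1 - 7 * q / 8) * C * real k"
      by (simp add: C_def mult_ac)
    then show ?thesis unfolding d_def ex_avg_deg_def using k by (simp add: pos_divide_le_eq)
  qed
  have A_ge: "(1 - x * real r) * C \<le> A"
  proof -
    have "real t \<le> real (m * t)" using mt(2) by (simp only: of_nat_le_iff)
    then have "real t * real (r - 1) \<le> real (m * t) * real r" by (intro mult_mono) auto
    then have "real t * real (r - 1) / real n \<le> x * real r"
      unfolding x_def by (simp add: divide_right_mono)
    then have "(1 - x * real r) * C \<le> (1 - real t * real (r - 1) / real n) * C"
      using Cpos by (intro mult_right_mono) auto
    then show ?thesis using choose_diff_ge[of t n "r - 1"] mt k(4) by (simp add: A_def C_def)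
  qed
  show False
    by (rule degree_budget_contradiction[OF q q_less Cpos d0 d_le _ _ _ x0 xr A_ge le])
      (use t(1) m2 r2 in auto)
qed

section \<open>Structure of the extremal graphs by induction on \<open>t\<close>\<close>

lemma extremal_structure:
  fixes H :: "nat hypergraph"
  assumes "N + m * t \<le> n" "real t \<le> \<epsilon> * real n"
    and "rgraph r H" "card (verts H) = n" "nu F H \<le> t"
    and "real (n choose r) - real ((n - t) choose r) + real (ex_num r (n - t) F)
           \<le> real (card (edges H))"
  shows "\<exists>S H'. finite S \<and> card S = t \<and> disjnt S (verts H') \<and>
           H' \<in> EX_fam r (n - t) F \<and> H = cone r S H'"
  using assms
proof (induction t arbitrary: n H)
  case 0
  \<comment> \<open>For \<open>t = 0\<close> the hypotheses say that \<open>H\<close> is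
    \<open>F\<close>-free with at least \<open>ex_num r n F\<close> edges.\<close>
  have "F_free F H" using 0 by (simp add: F_free_def)
  moreover from this have "card (edges H) \<le> ex_num r n F"
    using card_edges_le_ex_num 0 by blast
  ultimately have "H \<in> EX_fam r n F" using 0 by (simp add: EX_fam_def)
  moreover have "H = cone r {} H" by (rule hypergraph.equality) (auto simp: cone_def)
  ultimately show ?case by (intro exI[of _ "{}"] exI[of _ H]) simp
next
  case (Suc t)
  note H = Suc.prems(3,4)
  have fin: "finite (verts H)" using H(1) by (simp add: rgraph_def)
  obtain v where v: "v \<in> verts H" "nu F (delete H {v}) \<le> t"
    using vertex_of_large_degree[of "Suc t" n H] Suc.prems by auto
  have "1 * Suc t \<le> m * Suc t" using m2 by (intro mult_le_mono1) simp
  from order_trans[OF this add_leD2[OF Suc.prems(1)]] have "Suc t \<le> n" by simp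
  then have n: "n \<ge> 1" "Suc t \<le> n" by simp_all
  let ?H = "delete H {v}"
  have rH: "rgraph r ?H" using H(1) by (rule rgraph_delete)
  have cH: "card (verts ?H) = n - 1" using v(1) fin H(2) by simp
  have "(n choose r) = ((n - 1) choose r) + ((n - 1) choose (r - 1))"
    using choose_reduce_nat[of n r] n r2 by simp
  then have pascal: "real (n choose r) = real ((n - 1) choose r) + real ((n - 1) choose (r - 1))"
    by (metis of_nat_add)
  have deg: "real (card (edges H)) = real (card (edges ?H)) + real (vdegree H v)"
    using card_edges_delete_vertex[OF H(1), of v] by (metis of_nat_add)
  have deg_le: "vdegree H v \<le> (n - 1) choose (r - 1)"
    using vdegree_le_choose[OF H(1) _ v(1)] r2 H(2) by simp
  \<comment> \<open>Passing from \<open>(n, t + 1)\<close> to \<open>(n - 1, t)\<close> leaves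
    \<open>n - t - 1\<close> unchanged apart from the growth term \<open>n choose r\<close>, so by
    Pascal the required edge count drops by exactly the largest possible degree of
    \<open>v\<close>.\<close>
  have nt: "n - 1 - t = n - Suc t" by simp
  have lower: "real ((n - 1) choose r) - real ((n - 1 - t) choose r) + real (ex_num r (n - 1 - t) F)
      \<le> real (card (edges ?H))"
    using Suc.prems(6) pascal deg deg_le unfolding nt by linarith
  \<comment> \<open>With this, \<open>t + 1 \<le> \<epsilon> n\<close> implies
    \<open>t \<le> \<epsilon> (n - 1)\<close>.\<close>
  have "\<epsilon> \<le> 1"
  proof -
    have "1 \<le> 64 * real r * (real m)\<^sup>2"
    proof -
      have "1 \<le> r * m\<^sup>2" using r2 m2 by simp
      then have "1 \<le> real r * (real m)\<^sup>2" by (metis of_nat_1 of_nat_le_iff of_nat_mult of_nat_power)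
      then show ?thesis by simp
    qed
    then have "q / (64 * real r * (real m)\<^sup>2) \<le> 1" using q_less by (simp add: divide_le_eq)
    then show ?thesis using eps_q by simp
  qed
  then have "real t \<le> \<epsilon> * real (n - 1)"
    using Suc.prems(2) n by (simp add: of_nat_diff algebra_simps)
  moreover have "N + m * t \<le> n - 1" using Suc.prems(1) m2 by simp
  ultimately obtain S H' where IH: "finite S" "card S = t" "disjnt S (verts H')"
    "H' \<in> EX_fam r (n - 1 - t) F" "?H = cone r S H'"
    using Suc.IH[OF _ _ rH cH v(2) lower] by blast
  have H': "rgraph r H'" "card (verts H') = n - 1 - t" "card (edges H') = ex_num r (n - 1 - t) F"
    using IH(4) by (auto simp: EX_fam_def)
  have verts_eq: "S \<union> verts H' = verts H - {v}" using arg_cong[OF IH(5), of verts] by simp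
  \<comment> \<open>The structure of \<open>H - v\<close> fixes its edge count at the lower bound,
    so all remaining edges of \<open>H\<close> must contain \<open>v\<close>.\<close>
  have "card (edges ?H) + ((n - 1 - t) choose r) = ex_num r (n - 1 - t) F + ((n - 1) choose r)"
    using card_edges_cone[OF H'(1) IH(1,3)] H'(2,3) IH(5) cH verts_eq by simp
  then have "real (card (edges ?H)) + real ((n - 1 - t) choose r)
      = real (ex_num r (n - 1 - t) F) + real ((n - 1) choose r)"
    by (metis of_nat_add)
  then have "real ((n - 1) choose (r - 1)) \<le> real (vdegree H v)"
    using Suc.prems(6) pascal deg unfolding nt by linarith
  then have full: "(n - 1) choose (r - 1) \<le> vdegree H v" by simp
  \<comment> \<open>A subfamily of full cardinality is everything, so \<open>v\<close> can be added
    to \<open>S\<close>.\<close>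
  have "{e \<in> edges H. v \<in> e} = {e. e \<subseteq> verts H \<and> card e = r \<and> {v} \<subseteq> e}"
  proof (rule card_seteq)
    show "finite {e. e \<subseteq> verts H \<and> card e = r \<and> {v} \<subseteq> e}" using fin by simp
    show "{e \<in> edges H. v \<in> e} \<subseteq> {e. e \<subseteq> verts H \<and> card e = r \<and> {v} \<subseteq> e}"
      using H(1) by (auto simp: rgraph_def)
    show "card {e. e \<subseteq> verts H \<and> card e = r \<and> {v} \<subseteq> e} \<le> card {e \<in> edges H. v \<in> e}"
      using card_supersets[OF fin, of "{v}" r] v(1) r2 H(2) full by (simp add: vdegree_def)
  qed
  then have star: "e \<in> edges H \<longleftrightarrow> e \<subseteq> verts H \<and> card e = r" if "v \<in> e" for e
    using that by blast
  have rest: "e \<in> edges H \<longleftrightarrow>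
      e \<in> edges H' \<or> e \<subseteq> S \<union> verts H' \<and> card e = r \<and> e \<inter> S \<noteq> {}" if "v \<notin> e" for e
  proof -
    have "e \<in> edges H \<longleftrightarrow> e \<in> edges ?H" using that by simp
    also have "\<dots> \<longleftrightarrow> e \<in> edges (cone r S H')" by (simp only: IH(5))
    finally show ?thesis by (simp add: edges_cone)
  qed
  have vS: "v \<notin> S" "v \<notin> verts H'" "verts H = insert v (S \<union> verts H')"
    using verts_eq v(1) by auto
  have "H = cone r (insert v S) H'"
  proof (rule hypergraph.equality)
    show "edges H = edges (cone r (insert v S) H')"
    proof (rule set_eqI)
      fix e
      show "e \<in> edges H \<longleftrightarrow> e \<in> edges (cone r (insert v S) H')"
      proof (cases "v \<in> e")
        case True
        then have "e \<notin> edges H'" using vS(2) H'(1) by (auto simp: rgraph_def)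
        then show ?thesis using star[OF True] True vS(3) by (auto simp: edges_cone)
      next
        case False
        then have "e \<subseteq> insert v S \<union> verts H' \<longleftrightarrow> e \<subseteq> S \<union> verts H'"
          "e \<inter> insert v S = e \<inter> S" by auto
        then show ?thesis using rest[OF False] False by (simp add: edges_cone)
      qed
    qed
  qed (use vS(3) in auto)
  then show ?case
    using IH vS nt by (intro exI[of _ "insert v S"] exI[of _ H']) (simp add: disjnt_insert1)
qed

text \<open>All joins have admissible \<open>nu\<close> and the same number \<open>L\<close> of
  edges, and an admissible host with at least \<open>L\<close> edges is such a join. Hence
  \<open>L\<close> is the maximum and the joins are exactly the hosts attaining it.\<close>

lemma extremal_families:
  assumes "N + m * t \<le> n" "real t \<le> \<epsilon> * real n"
  shows "EX_fam_mult r n (t + 1) F = join_family r (complete_rgraph r t) (EX_fam r (n - t) F)"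
    and "int (ex_num_mult r n (t + 1) F)
           = int (n choose r) - int ((n - t) choose r) + int (ex_num r (n - t) F)"
proof -
  let ?J = "{cone r S H |S H. finite S \<and> card S = t \<and> disjnt S (verts H) \<and> H \<in> EX_fam r (n - t) F}"
  let ?E = "{card (edges H) |H :: nat hypergraph. rgraph r H \<and> card (verts H) = n \<and> nu F H < t + 1}"
  have "t \<le> m * t" "m * t \<le> n" using assms(1) m2 by auto
  then have tn: "t \<le> n" by (rule order_trans)
  have "(n - t) choose r \<le> n choose r" by (rule binomial_right_mono) simp
  \<comment> \<open>An additive equation for \<open>L\<close> matches \<open>card_edges_cone\<close>
    and avoids truncated subtraction.\<close>
  then obtain L where L: "L + ((n - t) choose r) = ex_num r (n - t) F + (n choose r)"
    using that[of "ex_num r (n - t) F + (n choose r) - ((n - t) choose r)"] by simp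
  have J: "rgraph r G \<and> card (verts G) = n \<and> nu F G < t + 1 \<and> card (edges G) = L"
    if GJ: "G \<in> ?J" for G
  proof -
    obtain S H where G: "G = cone r S H" and S: "finite S" "card S = t" "disjnt S (verts H)"
      and "H \<in> EX_fam r (n - t) F" using GJ by auto
    then have H: "rgraph r H" "card (verts H) = n - t" "F_free F H"
      "card (edges H) = ex_num r (n - t) F" by (auto simp: EX_fam_def)
    have fin: "finite (verts H)" using H(1) by (simp add: rgraph_def)
    have "S \<inter> verts H = {}" using S(3) by (simp add: disjnt_def)
    then have "card (S \<union> verts H) = n"
      using card_Un_disjoint[OF S(1) fin] S(2) H(2) tn by simp
    then show ?thesis
      using G rgraph_cone[OF H(1) S(1)] nu_cone_le[OF F H(1,3) S(1)] S(2)
        card_edges_cone[OF H(1) S(1,3)] H(2,4) L by simp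
  qed
  have large: "G \<in> ?J"
    if G: "rgraph r G" "card (verts G) = n" "nu F G < t + 1" "L \<le> card (edges G)" for G
  proof -
    have "real L + real ((n - t) choose r) = real (ex_num r (n - t) F) + real (n choose r)"
      using L by (metis of_nat_add)
    then have "real (n choose r) - real ((n - t) choose r) + real (ex_num r (n - t) F)
        \<le> real (card (edges G))" using G(4) by linarith
    then obtain S H where "finite S \<and> card S = t \<and> disjnt S (verts H) \<and>
        H \<in> EX_fam r (n - t) F \<and> G = cone r S H"
      using extremal_structure[OF assms G(1,2)] G(3) by auto
    then show ?thesis by blast
  qed
  obtain H where H: "H \<in> EX_fam r (n - t) F" using EX_fam_nonempty by blast
  then have fin: "finite (verts H)" by (simp add: EX_fam_def rgraph_def)
  \<comment> \<open>Hosts live on natural numbers, so \<open>t\<close> fresh vertices are always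
    available and some join exists.\<close>
  obtain S where S: "finite S" "card S = t" "S \<subseteq> UNIV - verts H"
    using infinite_arbitrarily_large[of "UNIV - verts H" t] Diff_infinite_finite[OF fin infinite_UNIV_nat]
    by blast
  have "disjnt S (verts H)" using S(3) by (auto simp: disjnt_iff)
  then have G: "cone r S H \<in> ?J" using S H by blast
  have max: "ex_num_mult r n (t + 1) F = L"
    unfolding ex_num_mult_def
  proof (rule Max_eqI)
    show "finite ?E" by (rule finite_ex_set)
    show "L \<in> ?E" using J[OF G] by blast
    show "y \<le> L" if y: "y \<in> ?E" for y
    proof -
      obtain K :: "nat hypergraph" where K: "y = card (edges K)" "rgraph r K" "card (verts K) = n"
        "nu F K < t + 1" using y by blast
      show ?thesis
      proof (cases "L \<le> y")
        case True
        then show ?thesis using J[OF large[OF K(2-4)]] K(1) by simp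
      qed simp
    qed
  qed
  have "EX_fam_mult r n (t + 1) F = ?J"
  proof (intro equalityI subsetI)
    fix G assume "G \<in> EX_fam_mult r n (t + 1) F"
    then show "G \<in> ?J" using large max by (simp add: EX_fam_mult_def)
  next
    fix G assume "G \<in> ?J"
    from J[OF this] show "G \<in> EX_fam_mult r n (t + 1) F" using max by (simp add: EX_fam_mult_def)
  qed
  then show "EX_fam_mult r n (t + 1) F = join_family r (complete_rgraph r t) (EX_fam r (n - t) F)"
    using join_family_complete[OF F] r2 by simp
  have "int L + int ((n - t) choose r) = int (ex_num r (n - t) F) + int (n choose r)"
    using L by (metis of_nat_add)
  then show "int (ex_num_mult r n (t + 1) F)
      = int (n choose r) - int ((n - t) choose r) + int (ex_num r (n - t) F)"
    using max by simp
qed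

end

section \<open>Nondegeneracy forces an edge\<close>

text \<open>For edgeless \<open>F\<close> and \<open>n \<ge> m\<close> no host is \<open>F\<close>-free, so \<open>ex_num r n F\<close> is the junk value
  \<open>Max {}\<close>, a constant, and the limit defining the density is still \<open>0\<close>.\<close>

lemma nondegenerate_edges:
  assumes "r \<ge> 2" "rgraph r F" "card (verts F) = m" "nondegenerate r F"
  shows "edges F \<noteq> {}"
proof
  assume empty: "edges F = {}"
  have finF: "finite (verts F)" using assms(2) by (simp add: rgraph_def)
  have ex: "ex_num r n F = Max {}" if "n \<ge> m" for n
  proof -
    have "\<not> F_free F H" if H: "rgraph r H" "card (verts H) = n" for H :: "nat hypergraph"
    proof -
      have "finite (verts H)" using H(1) by (simp add: rgraph_def)
      then obtain f where "f ` verts F \<subseteq> verts H" "inj_on f (verts F)"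
        using card_le_inj[OF finF, of "verts H"] assms(3) H(2) \<open>n \<ge> m\<close> by auto
      then have "embeds F H" using empty by (auto simp: embeds_def)
      then show ?thesis using F_free_iff[OF H(1), of F] by simp
    qed
    then have "{card (edges H) |H :: nat hypergraph.
        rgraph r H \<and> card (verts H) = n \<and> F_free F H} = {}" by blast
    then show ?thesis unfolding ex_num_def by (rule arg_cong)
  qed
  define K where "K = real (Max {} :: nat)"
  have "(\<lambda>n. K / real (n choose r)) \<longlonglongrightarrow> 0"
  proof (rule tendsto_divide_0[OF tendsto_const])
    have "filterlim (\<lambda>n. n choose r) at_top sequentially"
    proof (rule filterlim_at_top_mono[where f = "\<lambda>n. n - r"])
      show "filterlim (\<lambda>n. n - r) at_top sequentially"
        by (rule filterlim_minus_const_nat_at_top)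
      \<comment> \<open>From \<open>n = r\<close> on, every step of Pascal's rule adds at least one,
        which suffices for divergence.\<close>
      have "n - r \<le> n choose r" for n
      proof (induction n)
        case (Suc n)
        obtain j where r: "r = Suc j" using assms(1) by (cases r) auto
        show ?case
        proof (cases "r \<le> n")
          case True
          then have "n choose j > 0" "Suc n - r = Suc (n - r)" using r by simp_all
          moreover have "Suc n choose r = (n choose j) + (n choose r)" by (simp add: r)
          ultimately show ?thesis using Suc.IH by linarith
        qed simp
      qed simp
      then show "\<forall>\<^sub>F n in sequentially. n - r \<le> n choose r" by simp
    qed
    then show "filterlim (\<lambda>n. real (n choose r)) at_infinity sequentially"
      by (intro filterlim_at_top_imp_at_infinity filterlim_compose[OF filterlim_real_sequentially])
  qed
  moreover have "\<forall>\<^sub>F n in sequentially. K / real (n choose r) = real (ex_num r n F) / real (n choose r)"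
    using eventually_ge_at_top[of m] by eventually_elim (simp add: ex K_def)
  ultimately have "(\<lambda>n. real (ex_num r n F) / real (n choose r)) \<longlonglongrightarrow> 0"
    by (rule Lim_transform_eventually)
  then have "turan_density r F = 0" unfolding turan_density_def by (rule limI)
  then show False using assms(4) by (simp add: nondegenerate_def)
qed

section \<open>Choice of the thresholds and conclusion\<close>

theorem theorem1p7:
  fixes r m :: nat and F :: "'b hypergraph" and c :: real
  assumes "m \<ge> r" and "r \<ge> 2"
    and "rgraph r F" and "card (verts F) = m"
    and "nondegenerate r F"
    and "c > 0"
    and "\<forall>\<^sub>F n in sequentially.
           bounded_at r F n (c * real (n choose (r - 1)))
             ((1 - turan_density r F) / (4 * real m) * real (n choose (r - 1))) \<and>
           smooth_at r F n
             ((1 - turan_density r F) / (8 * real m) * real (n choose (r - 1)))"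
  shows "\<exists>N0. \<forall>n\<ge>N0. \<forall>t::nat.
           real t \<le> min (c / (4 * exp 1 * real r * real m) * real n)
                        ((1 - turan_density r F) / (64 * real r * (real m)^2) * real n) \<longrightarrow>
           EX_fam_mult r n (t + 1) F = join_family r (complete_rgraph r t) (EX_fam r (n - t) F) \<and>
           int (ex_num_mult r n (t + 1) F)
             = int (n choose r) - int ((n - t) choose r) + int (ex_num r (n - t) F)"
proof -
  define q where "q = 1 - turan_density r F"
  define \<epsilon> where "\<epsilon> = min (c / (4 * exp 1 * real r * real m)) (q / (64 * real r * (real m)\<^sup>2))"
  have q: "q < 1" using assms(5) by (simp add: q_def nondegenerate_def)
  have edges_F: "edges F \<noteq> {}"
    using nondegenerate_edges[OF assms(2-5)] .
  interpret turan r m F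
    by unfold_locales (use assms edges_F in auto)
  have lim: "(\<lambda>n. real (ex_num r n F) / real (n choose r)) \<longlonglongrightarrow> 1 - q"
    using convergent_ex_ratio by (simp add: q_def turan_density_def convergent_LIMSEQ_iff)
  have "\<forall>\<^sub>F j in sequentially. q > 0 \<longrightarrow> real (ex_num r j F) \<le> (1 - 7 * q / 8) * real (j choose r)"
  proof (cases "q > 0")
    case True
    \<comment> \<open>For \<open>q > 0\<close> the limit \<open>1 - q\<close> lies strictly below
      \<open>1 - 7 * q / 8\<close>.\<close>
    then have "\<forall>\<^sub>F j in sequentially. real (ex_num r j F) / real (j choose r) < 1 - 7 * q / 8"
      by (intro order_tendstoD(2)[OF lim]) simp
    moreover have "\<forall>\<^sub>F j in sequentially. j \<ge> r" by (rule eventually_ge_at_top)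
    ultimately show ?thesis
      by eventually_elim (simp add: pos_divide_less_eq)
  qed simp
  with assms(7) have "\<forall>\<^sub>F j in sequentially.
      (bounded_at r F j (c * real (j choose (r - 1))) (q / (4 * real m) * real (j choose (r - 1))) \<and>
       smooth_at r F j (q / (8 * real m) * real (j choose (r - 1)))) \<and>
      (q > 0 \<longrightarrow> real (ex_num r j F) \<le> (1 - 7 * q / 8) * real (j choose r))"
    unfolding q_def by (rule eventually_conj)
  then obtain N' where N': "\<And>j. j \<ge> N' \<Longrightarrow>
      (bounded_at r F j (c * real (j choose (r - 1))) (q / (4 * real m) * real (j choose (r - 1))) \<and>
       smooth_at r F j (q / (8 * real m) * real (j choose (r - 1)))) \<and>
      (q > 0 \<longrightarrow> real (ex_num r j F) \<le> (1 - 7 * q / 8) * real (j choose r))"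
    unfolding eventually_sequentially by blast
  \<comment> \<open>\<open>m \<le> N\<close> keeps all orders in the range where
    \<open>ex_num_mono\<close> applies.\<close>
  define N where "N = max m N'"
  interpret turan_smooth r m F c q \<epsilon> N
    by unfold_locales (use N' q assms(6) in \<open>auto simp: N_def \<epsilon>_def\<close>)
  show ?thesis
  \<comment> \<open>Twice \<open>N\<close>, because the bound on \<open>t\<close> and
    \<open>q < 1\<close> give \<open>m t \<le> n / 2\<close>, whence
    \<open>N + m t \<le> n\<close>.\<close>
  proof (intro exI[of _ "2 * N"] allI impI)
    fix n t :: nat
    assume n: "2 * N \<le> n"
      and t: "real t \<le> min (c / (4 * exp 1 * real r * real m) * real n)
                        ((1 - turan_density r F) / (64 * real r * (real m)^2) * real n)"
    have t_le: "real t \<le> \<epsilon> * real n"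
      using t unfolding \<epsilon>_def q_def by (simp add: min_mult_distrib_right)
    have "real m * real t \<le> real m * (q / (64 * real r * (real m)\<^sup>2) * real n)"
      using t by (intro mult_left_mono) (auto simp: q_def)
    also have "\<dots> = q / (64 * real r * real m) * real n"
      using m2 by (simp add: field_simps power2_eq_square)
    also have "\<dots> \<le> 1 / 2 * real n"
    proof (rule mult_right_mono)
      have "1 \<le> r * m" using r2 m2 by simp
      then have "1 \<le> real r * real m" by (metis of_nat_1 of_nat_le_iff of_nat_mult)
      then have "q \<le> 1 / 2 * (64 * real r * real m)" "0 < 64 * real r * real m"
        using q by linarith+
      then show "q / (64 * real r * real m) \<le> 1 / 2" by (simp only: pos_divide_le_eq)
    qed simp
    finally have "real (2 * (m * t)) \<le> real n" by simp
    then have "2 * (m * t) \<le> n" by (simp only: of_nat_le_iff)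
    then have "N + m * t \<le> n" using n by simp
    from extremal_families[OF this t_le]
    show "EX_fam_mult r n (t + 1) F = join_family r (complete_rgraph r t) (EX_fam r (n - t) F) \<and>
           int (ex_num_mult r n (t + 1) F)
             = int (n choose r) - int ((n - t) choose r) + int (ex_num r (n - t) F)"
      by blast
  qed
qed

end
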